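(* Let $R=K[x_1,\ldots,x_n]$ be a polynomial ring over a field $K$, let $I\subset R$ be a monomial ideal with minimal monomial generating set $G(I)$, and let $x_i$ be a variable that occurs in (divides some element of) $G(I)$. Put $$q=\max\{\deg_{x_i}(x^a)\mid x^a\in G(I)\},\quad \mathcal{B}_i=\{x^a\in G(I)\mid \deg_{x_i}(x^a)=q\},\quad \mathcal{A}_i=G(I)\setminus\mathcal{B}_i,$$ $$p=\max\{\deg_{x_i}(x^a)\mid x^a\in\mathcal{A}_i\},\qquad L=\bigl(\{x^a/x_i\mid x^a\in\mathcal{B}_i\}\cup\mathcal{A}_i\bigr).$$ Then the following hold. (a) If $p\geq 1$ and $q-p\geq 2$, then $\operatorname{depth}(R/I)=\operatorname{depth}(R/L)$. (b) If $p\geq 0$ and $q-p=1$, then $\operatorname{depth}(R/L)\geq\operatorname{depth}(R/I)$. (c) If $p=0$ and $q\geq 2$, then $\operatorname{depth}(R/I)=\operatorname{depth}\bigl(R/(\{x^a/x_i^{q-1}\mid x^a\in\mathcal{B}_i\}\cup\mathcal{A}_i)\bigr)$.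
   Context: For a monomial $x^a=x_1^{a_1}\cdots x_n^{a_n}$, $\deg_{x_i}(x^a)=a_i$. $G(I)$ is the unique minimal set of monomial generators of $I$. Depth is taken with respect to the graded maximal ideal $(x_1,\ldots,x_n)$, and $\operatorname{depth}(0)=\infty$. If $\mathcal{A}_i=\emptyset$, then $p=0$ by convention. *)

theory Defs
  imports
    "HOL-Algebra.Module"
    "HOL-Algebra.QuotRing"
    "HOL-Library.Poly_Mapping"
    "HOL-Library.Extended_Nat"
begin

definition ideal_times_module :: "'r ring \<Rightarrow> 'r set \<Rightarrow> ('r, 'm) module \<Rightarrow> 'm set" where
  "ideal_times_module R F M =
     \<Inter>{N. submodule N R M \<and> (\<forall>f\<in>F. \<forall>x\<in>carrier M. f \<odot>\<^bsub>M\<^esub> x \<in> N)}"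

text \<open>
  The first conjunct says that \<open>f\<^sub>k\<close> is a nonzerodivisor on \<open>M/(f\<^sub>0, \<dots>, f\<^sub>k\<^sub>-\<^sub>1)M\<close>, expressed for
  representatives in \<open>M\<close>.
\<close>

definition regular_sequence :: "'r ring \<Rightarrow> ('r, 'm) module \<Rightarrow> 'r list \<Rightarrow> bool" where
  "regular_sequence R M fs \<longleftrightarrow>
     (\<forall>k<length fs. \<forall>x\<in>carrier M.
        fs ! k \<odot>\<^bsub>M\<^esub> x \<in> ideal_times_module R (set (take k fs)) M \<longrightarrow>
        x \<in> ideal_times_module R (set (take k fs)) M) \<and>
     ideal_times_module R (set fs) M \<noteq> carrier M"

definition module_depth :: "'r ring \<Rightarrow> 'r set \<Rightarrow> ('r, 'm) module \<Rightarrow> enat" where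
  "module_depth R \<mm> M =
     (if carrier M = {\<zero>\<^bsub>M\<^esub>} then \<infinity>
      else SUP fs \<in> {fs. set fs \<subseteq> \<mm> \<and> regular_sequence R M fs}. enat (length fs))"

text \<open>The ring \<open>R/I\<close> regarded as an \<open>R\<close>-module, with \<open>r \<cdot> (s + I) = rs + I\<close>.\<close>

definition quotient_module :: "'r ring \<Rightarrow> 'r set \<Rightarrow> ('r, 'r set) module" where
  "quotient_module R I =
     ring.extend (R Quot I) (module.fields (\<lambda>r X. (I +>\<^bsub>R\<^esub> r) \<otimes>\<^bsub>R Quot I\<^esub> X))"

lemma quotient_module_simps:
  "carrier (quotient_module R I) = carrier (R Quot I)"
  "mult (quotient_module R I) = mult (R Quot I)"
  "one (quotient_module R I) = one (R Quot I)"
  "zero (quotient_module R I) = zero (R Quot I)"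
  "add (quotient_module R I) = add (R Quot I)"
  "smult (quotient_module R I) = (\<lambda>r X. (I +>\<^bsub>R\<^esub> r) \<otimes>\<^bsub>R Quot I\<^esub> X)"
  by (simp_all add: quotient_module_def ring.defs module.defs)

lemma quotient_module_module:
  fixes R :: "'r ring"
  assumes "cring R" "ideal I R"
  shows "Module.module R (quotient_module R I)"
proof -
  interpret ideal I R by fact
  interpret Q: ring "R Quot I" by (rule quotient_is_ring)
  have h: "(+>\<^bsub>R\<^esub>) I \<in> ring_hom R (R Quot I)" by (rule rcos_ring_hom)
  note hs = ring_hom_closed[OF h] ring_hom_add[OF h] ring_hom_mult[OF h] ring_hom_one[OF h]
  show ?thesis
  proof (rule moduleI)
    show "abelian_group (quotient_module R I)"
      by (rule abelian_groupI)
        (auto simp: quotient_module_simps Q.a_ac intro: Q.add.l_inv_ex)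
  qed (use assms hs in \<open>auto simp: quotient_module_simps Q.l_distr Q.r_distr Q.m_assoc\<close>)
qed

text \<open>
  A finite type \<open>'n\<close> indexes the variables: a monomial \<open>x\<^sup>a\<close> is identified with its exponent vector
  \<open>a :: 'n \<Rightarrow>\<^sub>0 nat\<close>, and a polynomial maps exponent vectors to
  coefficients.
\<close>

type_synonym ('n, 'k) mpoly = "('n \<Rightarrow>\<^sub>0 nat) \<Rightarrow>\<^sub>0 'k"

definition poly_ring :: "('n, 'k::field) mpoly ring" where
  "poly_ring = \<lparr>carrier = UNIV, mult = (*), one = 1, zero = 0, add = (+)\<rparr>"

lemma poly_ring_cring: "cring (poly_ring :: ('n, 'k::field) mpoly ring)"
proof (rule cringI)
  show "abelian_group (poly_ring :: ('n, 'k) mpoly ring)"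
    by (rule abelian_groupI) (auto simp: poly_ring_def algebra_simps intro: exI[of _ "- _"])
  show "comm_monoid (poly_ring :: ('n, 'k) mpoly ring)"
    by (rule comm_monoidI) (auto simp: poly_ring_def algebra_simps)
qed (auto simp: poly_ring_def algebra_simps)

definition monom_of :: "('n \<Rightarrow>\<^sub>0 nat) \<Rightarrow> ('n, 'k::field) mpoly" where
  "monom_of a = Poly_Mapping.single a 1"

definition deg_in :: "'n \<Rightarrow> ('n \<Rightarrow>\<^sub>0 nat) \<Rightarrow> nat" where
  "deg_in i a = Poly_Mapping.lookup a i"

definition var :: "'n \<Rightarrow> ('n \<Rightarrow>\<^sub>0 nat)" where
  "var i = Poly_Mapping.single i 1"

definition mono_ideal_gen :: "('n \<Rightarrow>\<^sub>0 nat) set \<Rightarrow> ('n, 'k::field) mpoly set" where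
  "mono_ideal_gen S = Idl\<^bsub>poly_ring\<^esub> (monom_of ` S)"

definition monomial_ideal :: "('n, 'k::field) mpoly set \<Rightarrow> bool" where
  "monomial_ideal I \<longleftrightarrow> (\<exists>S. I = mono_ideal_gen S)"

definition minimal_monomial_generators ::
    "('n, 'k::field) mpoly set \<Rightarrow> ('n \<Rightarrow>\<^sub>0 nat) set \<Rightarrow> bool" where
  "minimal_monomial_generators I G \<longleftrightarrow>
     mono_ideal_gen G = I \<and> (\<forall>H. H \<subset> G \<longrightarrow> mono_ideal_gen H \<noteq> I)"

definition depth_quotient :: "('n, 'k::field) mpoly set \<Rightarrow> enat" where
  "depth_quotient I =
     module_depth poly_ring (mono_ideal_gen (range var)) (quotient_module poly_ring I)"

end

theory Submission
  imports Defs "HOL-Library.Countable"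
begin

text \<open>
  Slice a monomial ideal \<open>I\<close> by the exponent of \<open>x\<^sub>i\<close>: let \<open>I\<^sub>t\<close> be the set of monomials \<open>w\<close> in the
  other variables with \<open>x\<^sub>i\<^sup>t w \<in> I\<close>. The chain \<open>I\<^sub>0 \<subseteq> I\<^sub>1 \<subseteq> \<dots>\<close> can grow only at the \<open>x\<^sub>i\<close>-degrees of
  the generators, so it is constant from \<open>p\<close> to \<open>q - 1\<close> and from \<open>q\<close> on. Dividing the generators
  of top degree \<open>q\<close> by \<open>x\<^sub>i\<^sup>m\<close>, where \<open>p \<le> q - m\<close>, deletes the members \<open>I\<^sub>t\<close> with \<open>q - m \<le> t < q\<close>
  from the chain (\<open>slices_of_lowered_top\<close>). In (a), with \<open>m = 1\<close>, and in (c), with \<open>m = q - 1\<close>,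
  every deleted member repeats its predecessor. In (b) the one deleted member is \<open>I\<^sub>p\<close>, which need
  not be a repetition.

  The depth is read off from Koszul homology. With \<open>n\<close> variables, \<open>R/J\<close> has a regular sequence of
  length \<open>d\<close> in \<open>(x\<^sub>1, \<dots>, x\<^sub>n)\<close> iff the Koszul homology of \<open>x\<^sub>1, \<dots>, x\<^sub>n\<close> on \<open>R/J\<close> vanishes in all
  degrees above \<open>n - d\<close> (\<open>regular_list_iff_koszul_exact\<close>). One direction follows from the long
  exact sequence of multiplication by a regular element, which lies in the ideal of the variables
  and therefore annihilates the homology. For the other, vanishing in degree \<open>n\<close> says that no
  nonzero element of \<open>R/J\<close> is killed by all variables; as \<open>R\<close> is noetherian (\<open>hilbert_basis\<close>),
  prime avoidance then yields a regular element (\<open>regular_element_exists\<close>), and one continues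
  modulo that element.

  For a monomial ideal the homology is \<open>\<int>\<^sup>n\<close>-graded. Its part in multidegree \<open>a\<close> is the homology of
  a complex with basis the sets \<open>S\<close> of variables such that \<open>x\<^sup>a\<close> divided by the product of \<open>S\<close> is a
  monomial outside \<open>I\<close> (\<open>koszul_exact_mono_set_iff\<close>). If \<open>a\<^sub>i = t > 0\<close>, only the pair \<open>I\<^sub>t\<^sub>-\<^sub>1, I\<^sub>t\<close> of
  members of the chain enters, and the family of sets is a cone with apex \<open>i\<close> if both agree; for
  \<open>t = 0\<close> only \<open>I\<^sub>0\<close> enters. So repeated members of the chain do not affect the depth
  (\<open>support_acyclic_remove_repeated_slices\<close>), which proves (a) and (c). For (b), the only new pair
  in the shortened chain is \<open>I\<^sub>p\<^sub>-\<^sub>1, I\<^sub>p\<^sub>+\<^sub>1\<close>, and its homology vanishes wherever that of the pairs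
  \<open>I\<^sub>p\<^sub>-\<^sub>1, I\<^sub>p\<close> and \<open>I\<^sub>p, I\<^sub>p\<^sub>+\<^sub>1\<close> does (\<open>support_acyclic_delete_slice\<close>); for \<open>p = 0\<close> the same holds with
  \<open>I\<^sub>p\<^sub>-\<^sub>1\<close> absent.
\<close>

section \<open>The Koszul complex and regular sequences\<close>

text \<open>
  A commutative ring is a module over itself; its submodules \<open>idl.subspace\<close> are the ideals, and
  \<open>idl.span\<close> is the ideal generated by a set.
\<close>

global_interpretation idl: Modules.module "(*) :: 'a::comm_ring_1 \<Rightarrow> 'a \<Rightarrow> 'a"
  by standard (simp_all add: algebra_simps)

(* This instance rewrites a * (b * x) to (a * b) * x and would make rewriting with ac_simps loop. *)
declare idl.scale_scale [simp del]

text \<open>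
  The sign of \<open>e\<^sub>i\<close> wedged with \<open>e\<^sub>S\<close> relative to the basis vector of \<open>{i} \<union> S\<close>. Any linear order of
  the variables serves; the one used comes from an injection into the natural numbers.
\<close>

definition koszul_sign :: "'n::finite \<Rightarrow> 'n set \<Rightarrow> 'a::comm_ring_1" where
  "koszul_sign i S = (- 1) ^ card {j \<in> S. to_nat j < to_nat i}"

lemma koszul_sign_square [simp]: "koszul_sign i S * koszul_sign i S = (1 :: 'a::comm_ring_1)"
  by (simp add: koszul_sign_def minus_one_power_iff)

text \<open>
  Exactly one of \<open>i\<close>, \<open>k\<close> precedes the other, so exactly one of the two signs on the left changes
  when the other index is inserted. This is the only property of the signs that the complex relies
  on.
\<close>

lemma koszul_sign_swap:
  assumes "i \<noteq> k" "i \<notin> T" "k \<notin> T"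
  shows "koszul_sign i (insert k T) * koszul_sign k (insert i T) =
    - (koszul_sign i T * koszul_sign k T :: 'a::comm_ring_1)"
proof -
  have ins: "(koszul_sign a (insert b T) :: 'a) =
      (if to_nat b < to_nat a then - koszul_sign a T else koszul_sign a T)" if "b \<notin> T" for a b
  proof -
    have "{j \<in> insert b T. to_nat j < to_nat a} =
        (if to_nat b < to_nat a then insert b {j \<in> T. to_nat j < to_nat a}
         else {j \<in> T. to_nat j < to_nat a})" by auto
    then show ?thesis using that by (simp add: koszul_sign_def)
  qed
  have "to_nat i < to_nat k \<or> to_nat k < to_nat i"
    using assms(1) by (meson linorder_neqE_nat to_nat_split)
  then show ?thesis using ins[OF assms(2), of k] ins[OF assms(3), of i] by auto
qed

lemma koszul_sign_swap':
  assumes "i \<noteq> k" "i \<notin> T" "k \<notin> T"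
  shows "koszul_sign i T * koszul_sign k (insert i T) =
    - (koszul_sign k T * koszul_sign i (insert k T) :: 'a::comm_ring_1)"
proof -
  have aux: "A * D = - (B * C)" if "C * D = - (A * B)" "A * A = 1" "C * C = 1" for A B C D :: 'a
  proof -
    have "A * D = (C * C) * (A * D)" using that by simp
    also have "\<dots> = A * C * (C * D)" by (simp only: ac_simps)
    also have "\<dots> = - ((A * A) * (B * C))" unfolding that(1) by (simp only: ac_simps mult_minus_right)
    finally show ?thesis using that by simp
  qed
  show ?thesis by (rule aux[OF koszul_sign_swap[OF assms] koszul_sign_square koszul_sign_square])
qed

text \<open>
  The Koszul differential. A chain gives a coefficient to every set of variables; chains in degree
  \<open>j\<close> are those supported on sets of size \<open>j\<close>.
\<close>

definition bdry :: "('n::finite \<Rightarrow> 'a::comm_ring_1) \<Rightarrow> ('n set \<Rightarrow> 'a) \<Rightarrow> 'n set \<Rightarrow> 'a" where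
  "bdry x c S = (\<Sum>i\<in>-S. koszul_sign i S * x i * c (insert i S))"

definition chain :: "nat \<Rightarrow> ('n::finite set \<Rightarrow> 'a::zero) \<Rightarrow> bool" where
  "chain j c \<longleftrightarrow> (\<forall>S. card S \<noteq> j \<longrightarrow> c S = 0)"

text \<open>
  The terms are paired off rather than the sum shown equal to its own negative, since the ring may
  have characteristic 2.
\<close>

lemma sum_antisym_offdiagonal:
  fixes g :: "'i \<Rightarrow> 'i \<Rightarrow> 'a::ab_group_add"
  assumes "finite A" "\<And>i k. i \<in> A \<Longrightarrow> k \<in> A \<Longrightarrow> i \<noteq> k \<Longrightarrow> g i k = - g k i"
  shows "(\<Sum>i\<in>A. \<Sum>k\<in>A - {i}. g i k) = 0"
  using assms
proof (induction A rule: finite_induct)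
  case empty
  then show ?case by simp
next
  case (insert a A)
  have 1: "insert a A - {i} = insert a (A - {i})" if "i \<in> A" for i
    using insert.hyps that by auto
  have 2: "insert a A - {a} = A" using insert.hyps by auto
  have IH: "(\<Sum>i\<in>A. \<Sum>k\<in>A - {i}. g i k) = 0"
    by (rule insert.IH) (rule insert.prems; simp)
  have "(\<Sum>i\<in>insert a A. \<Sum>k\<in>insert a A - {i}. g i k) =
      (\<Sum>k\<in>A. g a k) + (\<Sum>i\<in>A. \<Sum>k\<in>insert a (A - {i}). g i k)"
    using insert.hyps 2 1 by simp
  also have "(\<Sum>i\<in>A. \<Sum>k\<in>insert a (A - {i}). g i k) =
      (\<Sum>i\<in>A. g i a + (\<Sum>k\<in>A - {i}. g i k))"
    using insert.hyps by (intro sum.cong refl) simp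
  also have "\<dots> = (\<Sum>i\<in>A. - g a i)"
    unfolding sum.distrib IH add_0_right
    using insert.hyps by (intro sum.cong refl insert.prems) auto
  finally show ?case by (simp add: sum_negf)
qed

lemma bdry_bdry:
  fixes x :: "'n::finite \<Rightarrow> 'a::comm_ring_1"
  shows "bdry x (bdry x c) S = 0"
proof -
  have "bdry x (bdry x c) S =
      (\<Sum>i\<in>-S. \<Sum>k\<in>-S - {i}. koszul_sign i S * koszul_sign k (insert i S) *
        (x i * x k * c (insert k (insert i S))))"
    unfolding bdry_def
  proof (rule sum.cong[OF refl])
    fix i assume "i \<in> - S"
    have *: "- insert i S = - S - {i}" by auto
    show "koszul_sign i S * x i *
        (\<Sum>ia\<in>- insert i S. koszul_sign ia (insert i S) * x ia * c (insert ia (insert i S))) =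
      (\<Sum>k\<in>-S - {i}. koszul_sign i S * koszul_sign k (insert i S) *
        (x i * x k * c (insert k (insert i S))))"
      unfolding * sum_distrib_left by (intro sum.cong refl) (simp only: ac_simps)
  qed
  also have "\<dots> = 0"
  proof (rule sum_antisym_offdiagonal)
    fix i k assume "i \<in> - S" "k \<in> - S" "i \<noteq> k"
    then have *: "koszul_sign i S * koszul_sign k (insert i S) =
        (- (koszul_sign k S * koszul_sign i (insert k S)) :: 'a)"
      by (intro koszul_sign_swap') auto
    show "koszul_sign i S * koszul_sign k (insert i S) * (x i * x k * c (insert k (insert i S))) =
      - (koszul_sign k S * koszul_sign i (insert k S) * (x k * x i * c (insert i (insert k S))))"
      unfolding * insert_commute[of k i] by (simp only: mult_minus_left mult.commute[of "x i"])
  qed simp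
  finally show ?thesis .
qed

lemma bdry_add: "bdry x (\<lambda>S. c S + d S) S = bdry x c S + bdry x d S"
  by (simp add: bdry_def algebra_simps sum.distrib)

lemma bdry_diff: "bdry x (\<lambda>S. c S - d S) S = bdry x c S - bdry x d S"
  by (simp add: bdry_def algebra_simps sum_subtractf)

lemma bdry_scale: "bdry x (\<lambda>S. f * c S) S = f * bdry x c S"
  by (simp add: bdry_def sum_distrib_left ac_simps)

lemma bdry_zero [simp]: "bdry x (\<lambda>S. 0) S = 0"
  by (simp add: bdry_def)

lemma bdry_in_ideal:
  assumes "idl.subspace J" "\<And>S. c S \<in> J"
  shows "bdry x c S \<in> J"
  unfolding bdry_def using assms by (intro idl.subspace_sum) (auto intro: idl.subspace_scale)

lemma chain_bdry: "chain (Suc j) c \<Longrightarrow> chain j (bdry x c)"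
  by (auto simp: chain_def bdry_def intro!: sum.neutral)

text \<open>
  Exterior multiplication by \<open>\<Sum>\<^sub>k y\<^sub>k e\<^sub>k\<close>.
\<close>

definition homotopy :: "('n::finite \<Rightarrow> 'a::comm_ring_1) \<Rightarrow> ('n set \<Rightarrow> 'a) \<Rightarrow> 'n set \<Rightarrow> 'a" where
  "homotopy y c S = (\<Sum>k\<in>S. koszul_sign k (S - {k}) * y k * c (S - {k}))"

lemma chain_homotopy: "chain j c \<Longrightarrow> chain (Suc j) (homotopy y c)"
  unfolding chain_def homotopy_def
  by (intro allI impI sum.neutral ballI) (metis card_Suc_Diff1 finite mult_zero_right)

lemma homotopy_in_ideal:
  assumes "idl.subspace J" "\<And>S. c S \<in> J"
  shows "homotopy y c S \<in> J"
  unfolding homotopy_def using assms by (intro idl.subspace_sum) (auto intro: idl.subspace_scale)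

text \<open>
  The differential contracts with \<open>x\<close>, and contraction is an antiderivation, so the mixed terms
  cancel and \<open>\<Sum>\<^sub>i x\<^sub>i y\<^sub>i\<close> remains. Hence every element of the ideal generated by the \<open>x\<^sub>i\<close>
  annihilates Koszul homology.
\<close>

lemma bdry_homotopy:
  fixes x :: "'n::finite \<Rightarrow> 'a::comm_ring_1"
  shows "bdry x (homotopy y c) S + homotopy y (bdry x c) S = (\<Sum>i\<in>UNIV. x i * y i) * c S"
proof -
  define g where "g i k = koszul_sign i S * koszul_sign k (insert i S - {k}) *
      (x i * y k * c (insert i S - {k}))" for i k
  define h where "h i k = koszul_sign k (S - {k}) * koszul_sign i (S - {k}) *
      (x i * y k * c (insert i (S - {k})))" for i k
  have "bdry x (homotopy y c) S = (\<Sum>i\<in>-S. \<Sum>k\<in>insert i S. g i k)"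
    unfolding bdry_def homotopy_def g_def sum_distrib_left
    by (intro sum.cong refl) (simp only: ac_simps)
  also have "\<dots> = (\<Sum>i\<in>-S. g i i + (\<Sum>k\<in>S. g i k))"
    by (intro sum.cong refl) simp
  also have "\<dots> = (\<Sum>i\<in>-S. x i * y i * c S) + (\<Sum>i\<in>-S. \<Sum>k\<in>S. g i k)"
    unfolding sum.distrib by (simp add: g_def)
  finally have 1: "bdry x (homotopy y c) S = \<dots>" .
  have "homotopy y (bdry x c) S = (\<Sum>k\<in>S. \<Sum>i\<in>-(S - {k}). h i k)"
    unfolding bdry_def homotopy_def h_def sum_distrib_left
    by (intro sum.cong refl) (simp only: ac_simps)
  also have "\<dots> = (\<Sum>k\<in>S. h k k + (\<Sum>i\<in>-S. h i k))"
  proof (intro sum.cong refl)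
    fix k assume "k \<in> S"
    then have "-(S - {k}) = insert k (- S)" "k \<notin> - S" by auto
    then show "(\<Sum>i\<in>-(S - {k}). h i k) = h k k + (\<Sum>i\<in>-S. h i k)" by simp
  qed
  also have "\<dots> = (\<Sum>k\<in>S. x k * y k * c S) + (\<Sum>k\<in>S. \<Sum>i\<in>-S. h i k)"
    unfolding sum.distrib by (auto simp: h_def insert_absorb intro!: sum.cong)
  also have "(\<Sum>k\<in>S. \<Sum>i\<in>-S. h i k) = (\<Sum>i\<in>-S. \<Sum>k\<in>S. h i k)"
    by (rule sum.swap)
  also have "\<dots> = (\<Sum>i\<in>-S. \<Sum>k\<in>S. - g i k)"
  proof (intro sum.cong refl)
    fix i k assume ik: "i \<in> - S" "k \<in> S"
    define T where "T = S - {k}"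
    have S: "S = insert k T" "k \<notin> T" "i \<notin> T" "i \<noteq> k" using ik by (auto simp: T_def)
    have T: "insert i S - {k} = insert i T" using S by auto
    have "h i k = koszul_sign i T * koszul_sign k T * (x i * y k * c (insert i T))"
      by (simp add: h_def T_def ac_simps)
    also have "\<dots> = - (koszul_sign i (insert k T) * koszul_sign k (insert i T)) *
        (x i * y k * c (insert i T))"
      using koszul_sign_swap[OF S(4,3,2), where ?'a = 'a] by simp
    also have "\<dots> = - g i k"
      unfolding g_def T by (simp add: S(1))
    finally show "h i k = - g i k" .
  qed
  finally have 2: "homotopy y (bdry x c) S =
      (\<Sum>k\<in>S. x k * y k * c S) - (\<Sum>i\<in>-S. \<Sum>k\<in>S. g i k)"
    by (simp add: sum_negf)
  have "(\<Sum>i\<in>UNIV. x i * y i * c S) = (\<Sum>i\<in>-S. x i * y i * c S) + (\<Sum>k\<in>S. x k * y k * c S)"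
    using sum.union_disjoint[of "- S" S "\<lambda>i. x i * y i * c S"] by simp
  then show ?thesis unfolding 1 2 by (simp add: sum_distrib_right)
qed

text \<open>
  Vanishing of the \<open>j\<close>-th Koszul homology of the quotient by \<open>J\<close>, expressed by representatives in
  the ring itself.
\<close>

definition koszul_exact ::
    "('n::finite \<Rightarrow> 'a::comm_ring_1) \<Rightarrow> 'a set \<Rightarrow> nat \<Rightarrow> bool" where
  "koszul_exact x J j \<longleftrightarrow> (\<forall>c. chain j c \<and> (\<forall>S. bdry x c S \<in> J) \<longrightarrow>
     (\<exists>b. chain (Suc j) b \<and> (\<forall>S. c S - bdry x b S \<in> J)))"

definition regular_mod :: "'a::comm_ring_1 set \<Rightarrow> 'a \<Rightarrow> bool" where
  "regular_mod J f \<longleftrightarrow> (\<forall>r. f * r \<in> J \<longrightarrow> r \<in> J)"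

lemma in_span_insert_ideal:
  "idl.subspace J \<Longrightarrow> r \<in> idl.span (insert f J) \<longleftrightarrow> (\<exists>k. r - f * k \<in> J)"
  by (simp add: idl.span_breakdown_eq mult.commute idl.span_eq_iff[THEN iffD2])

text \<open>
  Division by \<open>f\<close> modulo \<open>J\<close>; the quotient is chosen to be zero where the chain is, so that it
  stays in the same degree.
\<close>

lemma lift_mod_insert:
  assumes "idl.subspace J" "chain j c" "\<And>S. c S \<in> idl.span (insert f J)"
  obtains e where "chain j e" "\<And>S. c S - f * e S \<in> J"
proof -
  have "\<exists>k. c S - f * k \<in> J \<and> (card S \<noteq> j \<longrightarrow> k = 0)" for S
  proof (cases "card S = j")
    case False
    then have "c S = 0" using assms(2) by (simp add: chain_def)
    then show ?thesis using idl.subspace_0[OF assms(1)] by (intro exI[of _ 0]) simp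
  qed (use assms in \<open>simp add: in_span_insert_ideal\<close>)
  then obtain e where "\<And>S. c S - f * e S \<in> J" "\<And>S. card S \<noteq> j \<longrightarrow> e S = 0" by metis
  then show thesis by (intro that[of e]) (auto simp: chain_def)
qed

text \<open>
  For \<open>M\<close> the quotient by \<open>J\<close>, the term \<open>H\<^sub>j\<^sub>+\<^sub>1(M/fM)\<close> lies between \<open>H\<^sub>j\<^sub>+\<^sub>1(M)\<close> and \<open>H\<^sub>j(M)\<close> in the
  long exact sequence of multiplication by \<open>f\<close>. Explicitly, the boundary of a cycle modulo \<open>f\<close> is
  \<open>f\<close> times a cycle of \<open>M\<close>, which bounds, and correcting by \<open>f\<close> times the bounding chain leaves a
  cycle of \<open>M\<close>.
\<close>

lemma koszul_exact_mod_regular: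
  assumes J: "idl.subspace J" and reg: "regular_mod J f"
    and "koszul_exact x J (Suc j)" "koszul_exact x J j"
  shows "koszul_exact x (idl.span (insert f J)) (Suc j)"
  unfolding koszul_exact_def
proof (intro allI impI, elim conjE)
  fix c assume c: "chain (Suc j) c" "\<forall>S. bdry x c S \<in> idl.span (insert f J)"
  obtain g where g: "chain j g" "\<And>S. bdry x c S - f * g S \<in> J"
    using lift_mod_insert[OF J chain_bdry[OF c(1)]] c(2) by blast
  have "f * bdry x g S \<in> J" for S
  proof -
    have "bdry x (\<lambda>S. bdry x c S - f * g S) S \<in> J" by (rule bdry_in_ideal[OF J g(2)])
    then show ?thesis
      using idl.subspace_neg[OF J] by (fastforce simp: bdry_diff bdry_scale bdry_bdry)
  qed
  then have "bdry x g S \<in> J" for S using reg by (auto simp: regular_mod_def)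
  then obtain b where b: "chain (Suc j) b" "\<And>S. g S - bdry x b S \<in> J"
    using assms(4) g(1) unfolding koszul_exact_def by blast
  have "bdry x (\<lambda>S. c S - f * b S) S \<in> J" for S
  proof -
    have "bdry x (\<lambda>S. c S - f * b S) S = (bdry x c S - f * g S) + f * (g S - bdry x b S)"
      by (simp add: bdry_diff bdry_scale algebra_simps)
    also have "\<dots> \<in> J" by (rule idl.subspace_add[OF J g(2) idl.subspace_scale[OF J b(2)]])
    finally show ?thesis .
  qed
  moreover have "chain (Suc j) (\<lambda>S. c S - f * b S)" using c(1) b(1) by (simp add: chain_def)
  ultimately obtain b' where b': "chain (Suc (Suc j)) b'"
      "\<And>S. (c S - f * b S) - bdry x b' S \<in> J"
    using assms(3) unfolding koszul_exact_def by blast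
  have "(c S - bdry x b' S) - f * b S \<in> J" for S
    using b'(2)[of S] by (simp add: algebra_simps)
  then show "\<exists>b. chain (Suc (Suc j)) b \<and> (\<forall>S. c S - bdry x b S \<in> idl.span (insert f J))"
    using b'(1) by (auto simp: in_span_insert_ideal[OF J])
qed

text \<open>
  If \<open>f\<close> is moreover in the ideal of the \<open>x\<^sub>i\<close>, the connecting map \<open>H\<^sub>j\<^sub>+\<^sub>1(M/fM) \<rightarrow> H\<^sub>j(M)\<close> is onto:
  the homotopy turns a cycle \<open>g\<close> of \<open>M\<close> into a chain with boundary \<open>f g\<close>, which is a cycle modulo
  \<open>f\<close>.
\<close>

lemma koszul_exact_below_of_mod_regular:
  assumes J: "idl.subspace J" and reg: "regular_mod J f" and f: "f = (\<Sum>i\<in>UNIV. x i * y i)"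
    and ex: "koszul_exact x (idl.span (insert f J)) (Suc j)"
  shows "koszul_exact x J j"
  unfolding koszul_exact_def
proof (intro allI impI, elim conjE)
  fix g assume g: "chain j g" "\<forall>S. bdry x g S \<in> J"
  define h where "h = homotopy y g"
  have h: "chain (Suc j) h" using chain_homotopy[OF g(1)] by (simp add: h_def)
  have bh: "bdry x h S - f * g S \<in> J" for S
  proof -
    have "bdry x h S - f * g S = - homotopy y (bdry x g) S"
      using bdry_homotopy[of x y g S] by (simp add: h_def f algebra_simps)
    also have "\<dots> \<in> J"
      using g(2) by (intro idl.subspace_neg[OF J] homotopy_in_ideal[OF J]) auto
    finally show ?thesis .
  qed
  then have "bdry x h S \<in> idl.span (insert f J)" for S
    by (auto simp: in_span_insert_ideal[OF J])
  then obtain b where b: "chain (Suc (Suc j)) b" "\<And>S. h S - bdry x b S \<in> idl.span (insert f J)"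
    using ex h unfolding koszul_exact_def by blast
  have "chain (Suc j) (\<lambda>S. h S - bdry x b S)"
    using h chain_bdry[OF b(1), of x] by (simp add: chain_def)
  from lift_mod_insert[OF J this b(2)]
  obtain e where e: "chain (Suc j) e" "\<And>S. h S - bdry x b S - f * e S \<in> J" by metis
  have "g S - bdry x e S \<in> J" for S
  proof -
    have "bdry x (\<lambda>S. h S - bdry x b S - f * e S) S = bdry x h S - f * bdry x e S"
      by (simp add: bdry_diff bdry_scale bdry_bdry)
    moreover have "bdry x (\<lambda>S. h S - bdry x b S - f * e S) S \<in> J"
      by (rule bdry_in_ideal[OF J e(2)])
    ultimately have "bdry x h S - f * bdry x e S \<in> J" by simp
    from idl.subspace_diff[OF J this bh[of S]] have "f * (g S - bdry x e S) \<in> J"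
      by (simp add: algebra_simps)
    then show ?thesis using reg by (auto simp: regular_mod_def)
  qed
  then show "\<exists>b. chain (Suc j) b \<and> (\<forall>S. g S - bdry x b S \<in> J)" using e(1) by blast
qed

text \<open>
  In top degree a cycle is an element killed by all \<open>x\<^sub>i\<close>, and there are no boundaries.
\<close>

lemma socle_free_of_koszul_exact:
  fixes x :: "'n::finite \<Rightarrow> 'a::comm_ring_1"
  assumes J: "idl.subspace J" and ex: "koszul_exact x J (card (UNIV :: 'n set))"
    and m: "\<And>i. x i * m \<in> J"
  shows "m \<in> J"
proof -
  define c where "c S = (if S = UNIV then m else 0)" for S :: "'n set"
  have ch: "chain (card (UNIV :: 'n set)) c" by (auto simp: chain_def c_def)
  have "bdry x c S \<in> J" for S
    unfolding bdry_def
  proof (rule idl.subspace_sum[OF J])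
    fix i
    have "koszul_sign i S * (x i * c (insert i S)) \<in> J"
      by (rule idl.subspace_scale[OF J]) (use m idl.subspace_0[OF J] in \<open>simp add: c_def\<close>)
    then show "koszul_sign i S * x i * c (insert i S) \<in> J" by (simp add: ac_simps)
  qed
  then obtain b where "\<And>S. c S - bdry x b S \<in> J"
    using ex ch unfolding koszul_exact_def by blast
  from this[of UNIV] show ?thesis by (simp add: c_def bdry_def)
qed

fun regular_list :: "'a::comm_ring_1 set \<Rightarrow> 'a list \<Rightarrow> bool" where
  "regular_list J [] \<longleftrightarrow> True"
| "regular_list J (f # fs) \<longleftrightarrow> regular_mod J f \<and> regular_list (idl.span (insert f J)) fs"

lemma koszul_exact_high:
  fixes x :: "'n::finite \<Rightarrow> 'a::comm_ring_1"
  assumes "idl.subspace J" "j > card (UNIV :: 'n set)"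
  shows "koszul_exact x J j"
proof -
  have "card S \<noteq> j" for S :: "'n set" using card_mono[of UNIV S] assms(2) by auto
  then show ?thesis unfolding koszul_exact_def chain_def
    using idl.subspace_0[OF assms(1)] by (auto intro!: exI[of _ "\<lambda>_. 0"])
qed

lemma in_span_range:
  fixes x :: "'n::finite \<Rightarrow> 'a::comm_ring_1"
  assumes "f \<in> idl.span (range x)"
  shows "\<exists>y. f = (\<Sum>i\<in>UNIV. x i * y i)"
  using assms
proof (induction rule: idl.span_induct_alt)
  case base
  show ?case by (intro exI[of _ "\<lambda>_. 0"]) simp
next
  case (step c v w)
  from step(1) obtain k where "v = x k" by auto
  moreover from step(2) obtain y where "w = (\<Sum>i\<in>UNIV. x i * y i)" by auto
  ultimately have "c * v + w = (\<Sum>i\<in>UNIV. x i * ((if i = k then c else 0) + y i))"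
    by (simp add: distrib_left sum.distrib if_distrib[of "\<lambda>z. x _ * z"] mult.commute cong: if_cong)
  then show ?case by metis
qed

text \<open>
  The Koszul characterisation of depth. The premise on regular elements is the only place where
  finiteness of the ring enters; it holds over noetherian rings.
\<close>

theorem regular_list_iff_koszul_exact:
  fixes x :: "'n::finite \<Rightarrow> 'a::comm_ring_1"
  assumes regular_element: "\<And>J. idl.subspace J \<Longrightarrow> (\<And>m. (\<And>i. x i * m \<in> J) \<Longrightarrow> m \<in> J) \<Longrightarrow>
      \<exists>f\<in>idl.span (range x). regular_mod J f"
    and "idl.subspace J"
  shows "(\<exists>fs. set fs \<subseteq> idl.span (range x) \<and> length fs = d \<and> regular_list J fs) \<longleftrightarrow>
    (\<forall>j. j + d > card (UNIV :: 'n set) \<longrightarrow> koszul_exact x J j)"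
  using assms(2)
proof (induction d arbitrary: J)
  case 0
  then show ?case by (auto intro: koszul_exact_high)
next
  case (Suc d)
  note J = Suc.prems
  let ?J = "\<lambda>f. idl.span (insert f J)"
  have IH: "(\<exists>fs. set fs \<subseteq> idl.span (range x) \<and> length fs = d \<and> regular_list (?J f) fs) \<longleftrightarrow>
    (\<forall>j. j + d > card (UNIV :: 'n set) \<longrightarrow> koszul_exact x (?J f) j)" for f
    by (rule Suc.IH) simp
  show ?case
  proof
    assume "\<exists>fs. set fs \<subseteq> idl.span (range x) \<and> length fs = Suc d \<and> regular_list J fs"
    then obtain f fs where f: "f \<in> idl.span (range x)" "regular_mod J f"
      and "set fs \<subseteq> idl.span (range x)" "length fs = d" "regular_list (?J f) fs"
      by (auto simp: length_Suc_conv)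
    then have ex: "koszul_exact x (?J f) j" if "j + d > card (UNIV :: 'n set)" for j
      using IH[of f] that by blast
    obtain y where y: "f = (\<Sum>i\<in>UNIV. x i * y i)" using in_span_range[OF f(1)] by blast
    show "\<forall>j. card (UNIV :: 'n set) < j + Suc d \<longrightarrow> koszul_exact x J j"
      using ex koszul_exact_below_of_mod_regular[OF Suc.prems f(2) y] by simp
  next
    assume ex: "\<forall>j. card (UNIV :: 'n set) < j + Suc d \<longrightarrow> koszul_exact x J j"
    then obtain f where f: "f \<in> idl.span (range x)" "regular_mod J f"
      using regular_element[OF Suc.prems] socle_free_of_koszul_exact[OF Suc.prems, of x] by auto
    have "koszul_exact x (?J f) j" if "card (UNIV :: 'n set) < j + d" for j
    proof (cases j)
      case (Suc j')
      show ?thesis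
        unfolding Suc
        by (rule koszul_exact_mod_regular[OF J f(2)]; rule ex[rule_format]) (use that Suc in auto)
    next
      case 0
      \<comment> \<open>Degree 0 has no predecessor for the exact sequence, but every 0-chain is a cycle,
        so exactness passes from \<open>J\<close> to the larger ideal directly.\<close>
      have "bdry x c S = 0" if "chain 0 c" for c :: "'n set \<Rightarrow> 'a" and S
        using that by (auto simp: chain_def bdry_def intro!: sum.neutral)
      moreover have "koszul_exact x J 0" using ex that 0 by simp
      moreover have "J \<subseteq> ?J f" by (meson idl.span_superset subset_insertI subset_trans)
      ultimately show ?thesis
        unfolding 0 koszul_exact_def by (metis idl.subspace_0[OF J] subsetD)
    qed
    then obtain fs where "set fs \<subseteq> idl.span (range x)" "length fs = d" "regular_list (?J f) fs"
      using IH[of f] by blast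
    then show "\<exists>fs. set fs \<subseteq> idl.span (range x) \<and> length fs = Suc d \<and> regular_list J fs"
      using f by (intro exI[of _ "f # fs"]) simp
  qed
qed

section \<open>Maximal annihilators and regular elements\<close>

definition noetherian :: "'a::comm_ring_1 itself \<Rightarrow> bool" where
  "noetherian _ \<longleftrightarrow> (\<forall>T :: 'a set. \<exists>F. finite F \<and> F \<subseteq> T \<and> T \<subseteq> idl.span F)"

definition colon :: "'a::comm_ring_1 set \<Rightarrow> 'a \<Rightarrow> 'a set" where
  "colon J m = {f. f * m \<in> J}"

lemma subspace_colon: "idl.subspace J \<Longrightarrow> idl.subspace (colon J m)"
  unfolding colon_def
  by (rule idl.subspaceI)
    (auto simp: distrib_right mult.assoc intro: idl.subspace_0 idl.subspace_add idl.subspace_scale)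

text \<open>
  A finite set of generators of the union of a chain already lies in one member, so the union is
  that member and Zorn's lemma applies.
\<close>

lemma noetherian_maximal:
  fixes \<A> :: "'a::comm_ring_1 set set"
  assumes noeth: "noetherian TYPE('a)"
    and "\<A> \<noteq> {}" "\<And>X. X \<in> \<A> \<Longrightarrow> idl.subspace X"
  shows "\<exists>P\<in>\<A>. \<forall>X\<in>\<A>. P \<subseteq> X \<longrightarrow> X = P"
proof (rule subset_Zorn_nonempty[OF assms(2)])
  fix \<C> assume \<C>: "\<C> \<noteq> {}" "subset.chain \<A> \<C>"
  then have sub: "idl.subspace X" if "X \<in> \<C>" for X
    using that assms(3) by (auto simp: subset.chain_def)
  obtain F where F: "finite F" "F \<subseteq> \<Union>\<C>" "\<Union>\<C> \<subseteq> idl.span F"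
    using noeth unfolding noetherian_def by blast
  obtain C where C: "C \<in> \<C>" "F \<subseteq> C"
    using finite_subset_Union_chain[OF F(1,2) \<C>] by auto
  then have "\<Union>\<C> \<subseteq> C" using F(3) idl.span_minimal sub by blast
  then have "\<Union>\<C> = C" using C(1) by auto
  then show "\<Union>\<C> \<in> \<A>" using C(1) \<C>(2) by (auto simp: subset.chain_def)
qed

definition maximal_annihilator :: "'a::comm_ring_1 set \<Rightarrow> 'a \<Rightarrow> bool" where
  "maximal_annihilator J m \<longleftrightarrow> m \<notin> J \<and> (\<forall>m'. m' \<notin> J \<and> colon J m \<subseteq> colon J m' \<longrightarrow> colon J m' = colon J m)"

lemma exists_maximal_annihilator:
  fixes J :: "'a::comm_ring_1 set"
  assumes noeth: "noetherian TYPE('a)" and J: "idl.subspace J" and "m \<notin> J"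
  shows "\<exists>m'. maximal_annihilator J m' \<and> colon J m \<subseteq> colon J m'"
proof -
  let ?A = "{colon J m' | m'. m' \<notin> J \<and> colon J m \<subseteq> colon J m'}"
  have "\<exists>P\<in>?A. \<forall>X\<in>?A. P \<subseteq> X \<longrightarrow> X = P"
    using assms(3) by (intro noetherian_maximal[OF noeth]) (auto simp: subspace_colon[OF J])
  then obtain P where P: "P \<in> ?A" and max: "\<And>X. X \<in> ?A \<Longrightarrow> P \<subseteq> X \<Longrightarrow> X = P"
    by (elim bexE) simp
  obtain m' where m': "P = colon J m'" "m' \<notin> J" "colon J m \<subseteq> colon J m'" using P by auto
  have "colon J m'' = colon J m'" if "m'' \<notin> J" "colon J m' \<subseteq> colon J m''" for m''
  proof -
    have "colon J m \<subseteq> colon J m''" using m'(3) that(2) by (rule subset_trans)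
    then have "colon J m'' \<in> ?A" using that(1) by blast
    then show ?thesis using max that(2) unfolding m'(1) by simp
  qed
  then show ?thesis using m'(2,3) unfolding maximal_annihilator_def by blast
qed

text \<open>
  If \<open>b\<close> does not annihilate \<open>m\<close> modulo \<open>J\<close>, then \<open>b m\<close> has the same annihilator as \<open>m\<close> by
  maximality.
\<close>

lemma prime_maximal_annihilator:
  assumes J: "idl.subspace J" and m: "maximal_annihilator J m" and ab: "a * b \<in> colon J m"
  shows "a \<in> colon J m \<or> b \<in> colon J m"
proof (rule disjCI)
  assume "b \<notin> colon J m"
  then have "b * m \<notin> J" by (simp add: colon_def)
  moreover have "colon J m \<subseteq> colon J (b * m)"
    using idl.subspace_scale[OF J] by (auto simp: colon_def mult.left_commute[of _ b])
  ultimately have "colon J (b * m) = colon J m"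
    using m by (auto simp: maximal_annihilator_def)
  moreover have "a \<in> colon J (b * m)" using ab by (simp add: colon_def mult.assoc)
  ultimately show "a \<in> colon J m" by simp
qed

lemma prod_notin_prime:
  fixes Q :: "'a::comm_ring_1 set"
  assumes "1 \<notin> Q" "\<And>a b. a * b \<in> Q \<Longrightarrow> a \<in> Q \<or> b \<in> Q" "finite F" "\<And>P. P \<in> F \<Longrightarrow> h P \<notin> Q"
  shows "prod h F \<notin> Q"
  using assms(3,4) by (induction F rule: finite_induct) (use assms(1,2) in auto)

text \<open>
  Incomparability of the primes simplifies the inductive step: if \<open>f\<close> avoids \<open>\<P>\<close> but lies in \<open>Q\<close>,
  add to it an element of \<open>M\<close> that lies in every member of \<open>\<P>\<close> and not in \<open>Q\<close>, built as a product.
\<close>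

lemma prime_avoidance:
  fixes M :: "'a::comm_ring_1 set"
  assumes "finite \<P>" "idl.subspace M"
    and "\<And>P. P \<in> \<P> \<Longrightarrow> idl.subspace P \<and> 1 \<notin> P \<and> (\<forall>a b. a * b \<in> P \<longrightarrow> a \<in> P \<or> b \<in> P)"
    and "\<And>P Q. P \<in> \<P> \<Longrightarrow> Q \<in> \<P> \<Longrightarrow> P \<subseteq> Q \<Longrightarrow> P = Q"
    and "\<And>P. P \<in> \<P> \<Longrightarrow> \<not> M \<subseteq> P"
  shows "\<exists>f\<in>M. \<forall>P\<in>\<P>. f \<notin> P"
  using assms(1,3,4,5)
proof (induction \<P> rule: finite_induct)
  case empty
  then show ?case using idl.subspace_0[OF assms(2)] by auto
next
  case (insert Q \<P>)
  have "\<exists>f\<in>M. \<forall>P\<in>\<P>. f \<notin> P"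
    using insert.prems by (intro insert.IH) auto
  then obtain f where f: "f \<in> M" "\<forall>P\<in>\<P>. f \<notin> P" by blast
  obtain m where m: "m \<in> M" "m \<notin> Q" using insert.prems(3)[of Q] by auto
  have "\<exists>h. h \<in> P \<and> h \<notin> Q" if "P \<in> \<P>" for P
    using insert.prems(2)[of P Q] that insert.hyps(2) by blast
  then obtain h where h: "\<And>P. P \<in> \<P> \<Longrightarrow> h P \<in> P \<and> h P \<notin> Q" by metis
  define g where "g = m * prod h \<P>"
  have Q: "idl.subspace Q" "1 \<notin> Q" "\<And>a b. a * b \<in> Q \<Longrightarrow> a \<in> Q \<or> b \<in> Q"
    using insert.prems(1)[of Q] by auto
  have gM: "g \<in> M" using idl.subspace_scale[OF assms(2) m(1), of "prod h \<P>"] by (simp add: g_def mult.commute)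
  have gQ: "g \<notin> Q"
    using m(2) Q(3) prod_notin_prime[OF Q(2,3) insert.hyps(1), of h] h unfolding g_def by blast
  have gP: "g \<in> P" if "P \<in> \<P>" for P
  proof -
    have "g = (m * prod h (\<P> - {P})) * h P"
      using that insert.hyps(1) by (simp add: g_def prod.remove mult.commute mult.left_commute)
    moreover have "idl.subspace P" using insert.prems(1)[of P] that by auto
    ultimately show ?thesis using h[OF that] idl.subspace_scale by metis
  qed
  show ?case
  proof (cases "f \<in> Q")
    case True
    have "f + g \<notin> Q"
      using gQ idl.subspace_diff[OF Q(1), of "f + g" f] True by auto
    moreover have "f + g \<notin> P" if "P \<in> \<P>" for P
      using f(2) that gP[OF that] idl.subspace_diff[of P "f + g" g] insert.prems(1)[of P] by auto
    ultimately show ?thesis using idl.subspace_add[OF assms(2) f(1) gM] by auto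
  next
    case False
    then show ?thesis using f by auto
  qed
qed

text \<open>
  Choose finitely many of the elements \<open>m\<close> with maximal annihilator that generate all the others.
  An element killing these generators kills every such \<open>m\<close>; so the prime annihilator of \<open>m\<close>
  contains the product of the annihilators of the generators, hence one of them, and equals it by
  maximality.
\<close>

lemma finite_maximal_annihilators:
  fixes J :: "'a::comm_ring_1 set"
  assumes noeth: "noetherian TYPE('a)" and J: "idl.subspace J"
  shows "finite (colon J ` {m. maximal_annihilator J m})"
proof -
  obtain F where F: "finite F" "F \<subseteq> {m. maximal_annihilator J m}"
      "{m. maximal_annihilator J m} \<subseteq> idl.span F"
    using noeth unfolding noetherian_def by blast
  have "colon J m \<in> colon J ` F" if m: "maximal_annihilator J m" for m
  proof (rule ccontr)
    assume "colon J m \<notin> colon J ` F"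
    moreover have "colon J m' = colon J m" if "m' \<in> F" "colon J m' \<subseteq> colon J m" for m'
      using that F(2) m by (auto simp: maximal_annihilator_def)
    ultimately have "\<exists>h. h \<in> colon J m' \<and> h \<notin> colon J m" if "m' \<in> F" for m'
      using that by blast
    then obtain h where h: "\<And>m'. m' \<in> F \<Longrightarrow> h m' \<in> colon J m' \<and> h m' \<notin> colon J m" by metis
    have "1 \<notin> colon J m" using m by (simp add: colon_def maximal_annihilator_def)
    then have "prod h F \<notin> colon J m"
      by (rule prod_notin_prime) (use prime_maximal_annihilator[OF J m] F(1) h in auto)
    moreover have "F \<subseteq> {r. prod h F * r \<in> J}"
    proof
      fix m' assume m': "m' \<in> F"
      have "prod h F * m' = prod h (F - {m'}) * (h m' * m')"
        using m' F(1) by (simp add: prod.remove mult.commute mult.left_commute)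
      then show "m' \<in> {r. prod h F * r \<in> J}"
        using h[OF m'] idl.subspace_scale[OF J] by (simp add: colon_def)
    qed
    then have "idl.span F \<subseteq> {r. prod h F * r \<in> J}"
    proof (rule idl.span_minimal)
      show "idl.subspace {r. prod h F * r \<in> J}"
        using subspace_colon[OF J, of "prod h F"] by (simp add: colon_def mult.commute)
    qed
    then have "prod h F \<in> colon J m" using F(3) m by (auto simp: colon_def)
    ultimately show False by simp
  qed
  then have "colon J ` {m. maximal_annihilator J m} \<subseteq> colon J ` F" by auto
  then show ?thesis by (rule finite_subset) (use F(1) in simp)
qed

text \<open>
  The zero divisors modulo \<open>J\<close> are the union of the finitely many maximal annihilators, and none
  of these primes contains all \<open>x\<^sub>i\<close>.
\<close>

theorem regular_element_exists:
  fixes x :: "'n \<Rightarrow> 'a::comm_ring_1"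
  assumes noeth: "noetherian TYPE('a)" and J: "idl.subspace J"
    and socle: "\<And>m. (\<And>i. x i * m \<in> J) \<Longrightarrow> m \<in> J"
  shows "\<exists>f\<in>idl.span (range x). regular_mod J f"
proof -
  let ?P = "colon J ` {m. maximal_annihilator J m}"
  have "\<exists>f\<in>idl.span (range x). \<forall>P\<in>?P. f \<notin> P"
  proof (rule prime_avoidance[OF finite_maximal_annihilators[OF noeth J]])
    fix P assume "P \<in> ?P"
    then obtain m where m: "P = colon J m" "maximal_annihilator J m" by auto
    then show "idl.subspace P \<and> 1 \<notin> P \<and> (\<forall>a b. a * b \<in> P \<longrightarrow> a \<in> P \<or> b \<in> P)"
      using subspace_colon[OF J] prime_maximal_annihilator[OF J]
      by (auto simp: maximal_annihilator_def colon_def)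
    have "m \<notin> J" using m(2) by (simp add: maximal_annihilator_def)
    then obtain i where "x i * m \<notin> J" using socle by blast
    then have "x i \<notin> P" by (simp add: m(1) colon_def)
    moreover have "x i \<in> idl.span (range x)" by (simp add: idl.span_base)
    ultimately show "\<not> idl.span (range x) \<subseteq> P" by blast
  next
    fix P Q assume "P \<in> ?P" "Q \<in> ?P" "P \<subseteq> Q"
    then show "P = Q" by (auto simp: maximal_annihilator_def)
  qed simp
  then obtain f where f: "f \<in> idl.span (range x)" "\<And>m. maximal_annihilator J m \<Longrightarrow> f \<notin> colon J m"
    by blast
  have "r \<in> J" if "f * r \<in> J" for r
  proof (rule ccontr)
    assume "r \<notin> J"
    then obtain m where "maximal_annihilator J m" "colon J r \<subseteq> colon J m"
      using exists_maximal_annihilator[OF noeth J] by blast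
    then show False using f(2) that by (auto simp: colon_def)
  qed
  then show ?thesis using f(1) by (auto simp: regular_mod_def)
qed

section \<open>Dickson's lemma and the Hilbert basis theorem\<close>

lemma nat_seq_mono_subseq:
  fixes s :: "nat \<Rightarrow> nat"
  shows "\<exists>r :: nat \<Rightarrow> nat. strict_mono r \<and> mono (\<lambda>k. s (r k))"
proof -
  obtain f :: "nat \<Rightarrow> nat" where f: "strict_mono f" "monoseq (\<lambda>n. s (f n))"
    using seq_monosub by blast
  from f(2) consider "mono (\<lambda>n. s (f n))" | "\<And>m n. m \<le> n \<Longrightarrow> s (f n) \<le> s (f m)"
    by (auto simp: monoseq_def mono_def)
  then show ?thesis
  proof cases
    case 2
    obtain N where N: "\<And>n. s (f N) \<le> s (f n)"
      using ex_has_least_nat[of "\<lambda>_. True" _ "\<lambda>n. s (f n)"] by auto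
    have "s (f (N + k)) = s (f N)" for k using N[of "N + k"] 2[of N "N + k"] by simp
    then have "mono (\<lambda>k. s (f (N + k)))" by (simp add: mono_def)
    moreover have "strict_mono (\<lambda>k. f (N + k))" using f(1) by (simp add: strict_mono_def)
    ultimately show ?thesis by blast
  qed (use f(1) in blast)
qed

text \<open>
  Pass to a subsequence that is nondecreasing in one coordinate, then in the next, and so on.
\<close>

lemma dickson_sequence:
  fixes f :: "nat \<Rightarrow> 'n::finite \<Rightarrow> nat"
  shows "\<exists>i j. i < j \<and> f i \<le> f j"
proof -
  have "finite V \<Longrightarrow> \<exists>r :: nat \<Rightarrow> nat. strict_mono r \<and> (\<forall>v\<in>V. mono (\<lambda>k. f (r k) v))" for V :: "'n set"
  proof (induction V rule: finite_induct)
    case empty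
    then show ?case by (intro exI[of _ id]) (simp add: strict_mono_def)
  next
    case (insert a V)
    then obtain r :: "nat \<Rightarrow> nat" where r: "strict_mono r" "\<forall>v\<in>V. mono (\<lambda>k. f (r k) v)" by blast
    obtain t :: "nat \<Rightarrow> nat" where t: "strict_mono t" "mono (\<lambda>k. f (r (t k)) a)"
      using nat_seq_mono_subseq[of "\<lambda>k. f (r k) a"] by blast
    have "strict_mono (\<lambda>k. r (t k))" using r(1) t(1) by (simp add: strict_mono_def)
    moreover have "mono (\<lambda>k. f (r (t k)) v)" if "v \<in> V" for v
      using r(2) that strict_mono_mono[OF t(1)] by (auto simp: mono_def)
    ultimately show ?case using t(2) by (intro exI[of _ "\<lambda>k. r (t k)"]) auto
  qed
  then obtain r :: "nat \<Rightarrow> nat" where r: "strict_mono r" "\<And>v. mono (\<lambda>k. f (r k) v)" by (metis UNIV_I finite)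
  have "r 0 < r 1" using r(1) by (simp add: strict_mono_def)
  moreover have "f (r 0) \<le> f (r 1)" using r(2) by (auto simp: le_fun_def mono_def)
  ultimately show ?thesis by blast
qed

lemma antichain_finite:
  fixes A :: "('n::finite \<Rightarrow> nat) set"
  assumes "\<And>a b. a \<in> A \<Longrightarrow> b \<in> A \<Longrightarrow> a \<le> b \<Longrightarrow> a = b"
  shows "finite A"
proof (rule ccontr)
  assume "infinite A"
  then obtain f :: "nat \<Rightarrow> 'n \<Rightarrow> nat" where f: "inj f" "range f \<subseteq> A"
    using infinite_countable_subset by blast
  obtain i j where "i < j" "f i \<le> f j" using dickson_sequence by blast
  then show False using assms[of "f i" "f j"] f by (auto dest: injD)
qed

lemma dickson:
  fixes A :: "('n::finite \<Rightarrow> nat) set"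
  shows "\<exists>B. finite B \<and> B \<subseteq> A \<and> (\<forall>a\<in>A. \<exists>b\<in>B. b \<le> a)"
proof -
  define B where "B = {b \<in> A. \<forall>a\<in>A. a \<le> b \<longrightarrow> a = b}"
  have "\<exists>b\<in>B. b \<le> a" if a: "a \<in> A" for a
  proof -
    \<comment> \<open>Among the elements of \<open>A\<close> below \<open>a\<close>, one of least coordinate sum is minimal.\<close>
    let ?w = "\<lambda>b :: 'n \<Rightarrow> nat. sum b UNIV"
    obtain b where b: "b \<in> A" "b \<le> a" "\<And>b'. b' \<in> A \<Longrightarrow> b' \<le> a \<Longrightarrow> ?w b \<le> ?w b'"
      using ex_has_least_nat[of "\<lambda>b. b \<in> A \<and> b \<le> a" a ?w] a by auto
    have "b' = b" if b': "b' \<in> A" "b' \<le> b" for b'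
    proof (rule ccontr)
      assume "b' \<noteq> b"
      then obtain i where "b' i < b i" using b'(2) by (metis ext le_funD le_neq_implies_less)
      then have "?w b' < ?w b" using b'(2) by (intro sum_strict_mono_ex1) (auto simp: le_fun_def)
      then show False using b(3)[of b'] b' order_trans[OF b'(2) b(2)] by auto
    qed
    then show ?thesis using b(1,2) by (auto simp: B_def)
  qed
  moreover have "finite B" by (rule antichain_finite) (auto simp: B_def)
  ultimately show ?thesis by (intro exI[of _ B]) (auto simp: B_def)
qed

text \<open>
  Transports exponent vectors to finitely supported sequences, whose lexicographic order is a
  linear order compatible with addition; it serves as the monomial order.
\<close>

definition lex_code :: "('n::finite \<Rightarrow>\<^sub>0 nat) \<Rightarrow> nat \<Rightarrow>\<^sub>0 nat" where
  "lex_code a = (\<Sum>i\<in>UNIV. Poly_Mapping.single (to_nat i) (Poly_Mapping.lookup a i))"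

lemma lex_code_add: "lex_code (a + b) = lex_code a + lex_code b"
  by (simp add: lex_code_def lookup_add single_add sum.distrib)

lemma lookup_lex_code: "Poly_Mapping.lookup (lex_code a) (to_nat i) = Poly_Mapping.lookup a i"
  by (simp add: lex_code_def lookup_sum lookup_single when_def)

lemma inj_lex_code: "lex_code a = lex_code b \<longleftrightarrow> a = b"
  by (metis lookup_lex_code poly_mapping_eqI)

lemma lex_code_mono:
  assumes "Poly_Mapping.lookup a \<le> Poly_Mapping.lookup b"
  shows "lex_code a \<le> lex_code b"
proof -
  have "b = a + (b - a)"
    using assms by (intro poly_mapping_eqI) (simp add: lookup_add lookup_minus le_fun_def)
  then have "lex_code b = lex_code a + lex_code (b - a)" by (metis lex_code_add)
  moreover have "\<not> lex_code (b - a) < 0"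
    by (simp add: less_poly_mapping.rep_eq less_fun_def)
  ultimately show ?thesis using add_left_mono[of 0 "lex_code (b - a)" "lex_code a"] by (simp add: not_less)
qed

text \<open>
  Any linear order that refines divisibility is a well-order, by Dickson's lemma.
\<close>

lemma wf_lex_code: "wf {(a, b). lex_code a < lex_code (b :: 'n::finite \<Rightarrow>\<^sub>0 nat)}"
  unfolding wf_iff_no_infinite_down_chain
proof
  assume "\<exists>f. \<forall>k. (f (Suc k), f k) \<in> {(a, b). lex_code a < lex_code (b :: 'n \<Rightarrow>\<^sub>0 nat)}"
  then obtain f :: "nat \<Rightarrow> 'n \<Rightarrow>\<^sub>0 nat" where f: "\<And>k. lex_code (f (Suc k)) < lex_code (f k)" by auto
  obtain i j where "i < j" "Poly_Mapping.lookup (f i) \<le> Poly_Mapping.lookup (f j)"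
    using dickson_sequence[of "\<lambda>k. Poly_Mapping.lookup (f k)"] by blast
  moreover have "lex_code (f j) < lex_code (f i)" if "i < j" for i j
    using that by (induction j) (use f less_Suc_eq order.strict_trans in \<open>blast+\<close>)
  ultimately show False using lex_code_mono by (metis not_less)
qed

lemma lookup_monomial_mult:
  fixes f :: "('n, 'k::field) mpoly"
  shows "Poly_Mapping.lookup (Poly_Mapping.single d c * f) e =
    (if Poly_Mapping.lookup d \<le> Poly_Mapping.lookup e then c * Poly_Mapping.lookup f (e - d) else 0)"
proof -
  have dvd: "Poly_Mapping.lookup d \<le> Poly_Mapping.lookup e \<longleftrightarrow> (\<exists>q. e = d + q)"
  proof
    assume "Poly_Mapping.lookup d \<le> Poly_Mapping.lookup e"
    then have "e = d + (e - d)"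
      by (intro poly_mapping_eqI) (simp add: lookup_add lookup_minus le_fun_def)
    then show "\<exists>q. e = d + q" by blast
  qed (auto simp: le_fun_def lookup_add)
  have "Poly_Mapping.lookup (Poly_Mapping.single d c * f) e =
      (\<Sum>l. (c when d = l) * (\<Sum>q. Poly_Mapping.lookup f q when e = l + q))"
    by (simp add: lookup_mult lookup_single)
  also have "\<dots> = c * (\<Sum>q. Poly_Mapping.lookup f q when e = d + q)"
  proof -
    have *: "(\<lambda>l. (c when d = l) * (\<Sum>q. Poly_Mapping.lookup f q when e = l + q)) =
        (\<lambda>l. c * (\<Sum>q. Poly_Mapping.lookup f q when e = d + q) when l = d)"
      by (auto simp: when_def)
    show ?thesis unfolding * by (rule Sum_any_when_equal)
  qed
  also have "\<dots> = (if Poly_Mapping.lookup d \<le> Poly_Mapping.lookup e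
      then c * Poly_Mapping.lookup f (e - d) else 0)"
  proof (cases "\<exists>q. e = d + q")
    case True
    then obtain q where q: "e = d + q" by blast
    then have *: "(\<lambda>q. Poly_Mapping.lookup f q when e = d + q) =
        (\<lambda>q'. Poly_Mapping.lookup f q' when q' = q)" by (auto simp: when_def)
    show ?thesis unfolding * Sum_any_when_equal using dvd True q by simp
  next
    case False
    then show ?thesis using dvd by simp
  qed
  finally show ?thesis .
qed

definition lead :: "('n::finite, 'k::field) mpoly \<Rightarrow> ('n \<Rightarrow>\<^sub>0 nat)" where
  "lead f = (ARG_MAX lex_code a. a \<in> Poly_Mapping.keys f)"

lemma lead:
  assumes "f \<noteq> 0"
  shows "lead f \<in> Poly_Mapping.keys f" "a \<in> Poly_Mapping.keys f \<Longrightarrow> lex_code a \<le> lex_code (lead f)"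
proof -
  have ne: "Poly_Mapping.keys f \<noteq> {}" using assms by simp
  have "Max (lex_code ` Poly_Mapping.keys f) \<in> lex_code ` Poly_Mapping.keys f"
    using ne by (intro Max_in) simp_all
  then obtain b where b: "b \<in> Poly_Mapping.keys f" "lex_code b = Max (lex_code ` Poly_Mapping.keys f)"
    by (elim imageE) simp
  have "is_arg_max lex_code (\<lambda>a. a \<in> Poly_Mapping.keys f) b"
    using b by (simp add: is_arg_max_def not_less)
  then have "is_arg_max lex_code (\<lambda>a. a \<in> Poly_Mapping.keys f) (lead f)"
    unfolding lead_def arg_max_def by (rule someI)
  then show "lead f \<in> Poly_Mapping.keys f" "a \<in> Poly_Mapping.keys f \<Longrightarrow> lex_code a \<le> lex_code (lead f)"
    by (auto simp: is_arg_max_def not_less)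
qed

text \<open>
  By Dickson's lemma finitely many leading exponents divide all others; division by the
  corresponding polynomials lowers the leading exponent.
\<close>

lemma hilbert_basis_ideal:
  fixes J :: "('n::finite, 'k::field) mpoly set"
  assumes J: "idl.subspace J"
  shows "\<exists>F. finite F \<and> F \<subseteq> J \<and> J \<subseteq> idl.span F"
proof -
  obtain B where B: "finite B" "B \<subseteq> (\<lambda>f. Poly_Mapping.lookup (lead f)) ` (J - {0})"
    and B': "\<And>f. f \<in> J \<Longrightarrow> f \<noteq> 0 \<Longrightarrow> \<exists>b\<in>B. b \<le> Poly_Mapping.lookup (lead f)"
    using dickson[of "(\<lambda>f. Poly_Mapping.lookup (lead f)) ` (J - {0})"] by blast
  obtain F where F: "finite F" "F \<subseteq> J - {0}" "B = (\<lambda>f. Poly_Mapping.lookup (lead f)) ` F"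
    using finite_subset_image[OF B] by blast
  have "f \<in> idl.span F" if "f \<in> J" for f
    using that
  proof (induction "lead f" arbitrary: f rule: wf_induct_rule[OF wf_lex_code])
    case (1 f)
    show ?case
    proof (cases "f = 0")
      case False
      then obtain g where g: "g \<in> F" "Poly_Mapping.lookup (lead g) \<le> Poly_Mapping.lookup (lead f)"
        using B' 1(2) F(3) by blast
      then have g': "g \<in> J" "g \<noteq> 0" using F(2) by auto
      define d where "d = lead f - lead g"
      have d: "lead f = d + lead g"
        using g(2) by (intro poly_mapping_eqI) (simp add: d_def lookup_add lookup_minus le_fun_def)
      define u where
        "u = Poly_Mapping.single d (Poly_Mapping.lookup f (lead f) / Poly_Mapping.lookup g (lead g))"
      define h where "h = f - u * g"
      have ug: "Poly_Mapping.lookup (u * g) e = (if Poly_Mapping.lookup d \<le> Poly_Mapping.lookup e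
          then Poly_Mapping.lookup f (lead f) / Poly_Mapping.lookup g (lead g) *
            Poly_Mapping.lookup g (e - d) else 0)" for e
        unfolding u_def by (rule lookup_monomial_mult)
      have "h \<in> J" unfolding h_def
        using idl.subspace_diff[OF J 1(2) idl.subspace_scale[OF J g'(1)]] .
      have "h \<in> idl.span F"
      proof (cases "h = 0")
        case False
        note h = lead[OF this]
        have lc: "Poly_Mapping.lookup g (lead g) \<noteq> 0" using lead(1)[OF g'(2)] by (simp add: in_keys_iff)
        have le: "lex_code (lead h) \<le> lex_code (lead f)"
        proof (cases "lead h \<in> Poly_Mapping.keys f")
          case False
          then have "Poly_Mapping.lookup (u * g) (lead h) \<noteq> 0"
            using h(1) by (auto simp: h_def in_keys_iff lookup_minus)
          then have *: "Poly_Mapping.lookup d \<le> Poly_Mapping.lookup (lead h)"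
              "lead h - d \<in> Poly_Mapping.keys g"
            unfolding ug by (auto simp: in_keys_iff split: if_splits)
          have "lead h = d + (lead h - d)"
            using *(1) by (intro poly_mapping_eqI) (simp add: lookup_add lookup_minus le_fun_def)
          then have "lex_code (lead h) = lex_code d + lex_code (lead h - d)"
            by (metis lex_code_add)
          also have "\<dots> \<le> lex_code d + lex_code (lead g)"
            using lead(2)[OF g'(2) *(2)] by (rule add_left_mono)
          finally show ?thesis by (simp add: d lex_code_add)
        qed (use lead(2)[OF \<open>f \<noteq> 0\<close>] in blast)
        have "Poly_Mapping.lookup h (lead f) = 0"
          using lc by (simp add: h_def lookup_minus ug) (simp add: d lookup_add le_fun_def)
        then have "lead h \<noteq> lead f" using h(1) by (auto simp: in_keys_iff)
        then have "lex_code (lead h) < lex_code (lead f)"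
          using le by (metis inj_lex_code order.not_eq_order_implies_strict)
        then show ?thesis using 1(1) \<open>h \<in> J\<close> by auto
      qed (simp add: idl.span_zero)
      moreover have "f = u * g + h" by (simp add: h_def)
      ultimately show ?thesis
        using idl.span_add[OF idl.span_scale[OF idl.span_base[OF g(1)]]] by metis
    qed (simp add: idl.span_zero)
  qed
  then show ?thesis using F(1,2) by blast
qed

theorem hilbert_basis: "noetherian TYPE(('n::finite, 'k::field) mpoly)"
  unfolding noetherian_def
proof
  fix T :: "('n, 'k) mpoly set"
  obtain E where E: "finite E" "E \<subseteq> idl.span T" "idl.span T \<subseteq> idl.span E"
    using hilbert_basis_ideal[of "idl.span T"] by auto
  have "\<exists>t. finite t \<and> t \<subseteq> T \<and> e \<in> idl.span t" if "e \<in> E" for e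
    using that E(2) unfolding idl.span_explicit by (force simp: idl.span_explicit)
  then obtain t where t: "\<And>e. e \<in> E \<Longrightarrow> finite (t e) \<and> t e \<subseteq> T \<and> e \<in> idl.span (t e)" by metis
  have "E \<subseteq> idl.span (\<Union>e\<in>E. t e)"
    using t idl.span_mono[of _ "\<Union>e\<in>E. t e"] by blast
  then have "idl.span E \<subseteq> idl.span (\<Union>e\<in>E. t e)" by (rule idl.span_minimal) simp
  then have "T \<subseteq> idl.span (\<Union>e\<in>E. t e)" using E(3) idl.span_superset by blast
  then show "\<exists>F. finite F \<and> F \<subseteq> T \<and> T \<subseteq> idl.span F"
    using E(1) t by (intro exI[of _ "\<Union>e\<in>E. t e"]) auto
qed

section \<open>Multigraded pieces of the Koszul complex of a monomial ideal\<close>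

definition up_closed :: "('n \<Rightarrow> nat) set \<Rightarrow> bool" where
  "up_closed U \<longleftrightarrow> (\<forall>u v. u \<in> U \<and> u \<le> v \<longrightarrow> v \<in> U)"

definition mono_set :: "('n \<Rightarrow> nat) set \<Rightarrow> ('n, 'k::field) mpoly set" where
  "mono_set U = {f. \<forall>a\<in>Poly_Mapping.keys f. Poly_Mapping.lookup a \<in> U}"

lemma mono_set_iff: "f \<in> mono_set U \<longleftrightarrow> (\<forall>a. Poly_Mapping.lookup a \<notin> U \<longrightarrow> Poly_Mapping.lookup f a = 0)"
  by (auto simp: mono_set_def in_keys_iff)

text \<open>
  The exponent of the squarefree monomial with support \<open>S\<close>, as a function; \<open>chi S\<close> below is the
  same exponent as a finitely supported function.
\<close>

definition ind :: "'n set \<Rightarrow> 'n \<Rightarrow> nat" where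
  "ind S k = of_bool (k \<in> S)"

definition chi :: "'n::finite set \<Rightarrow> 'n \<Rightarrow>\<^sub>0 nat" where
  "chi S = Abs_poly_mapping (ind S)"

lemma lookup_chi [simp]: "Poly_Mapping.lookup (chi S) = ind S"
  by (simp add: chi_def)

lemma ind_le_iff: "ind S \<le> a \<longleftrightarrow> (\<forall>k\<in>S. 1 \<le> a k)"
  by (auto simp: le_fun_def ind_def)

text \<open>
  Exactness in degree \<open>j\<close> of the complex over \<open>'k\<close> with basis \<open>D\<close>, whose differential is the
  Koszul differential with all variables set to \<open>1\<close>, followed by discarding the sets outside \<open>D\<close>.
  The field is passed as a type token because the statement quantifies over its chains only.
\<close>

definition acyclic_family :: "'k::field itself \<Rightarrow> 'n::finite set set \<Rightarrow> nat \<Rightarrow> bool" where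
  "acyclic_family _ D j \<longleftrightarrow> (\<forall>\<gamma> :: 'n set \<Rightarrow> 'k.
     chain j \<gamma> \<and> (\<forall>S. S \<notin> D \<longrightarrow> \<gamma> S = 0) \<and> (\<forall>S\<in>D. bdry (\<lambda>_. 1) \<gamma> S = 0) \<longrightarrow>
     (\<exists>\<beta>. chain (Suc j) \<beta> \<and> (\<forall>S. S \<notin> D \<longrightarrow> \<beta> S = 0) \<and> (\<forall>S\<in>D. \<gamma> S = bdry (\<lambda>_. 1) \<beta> S)))"

lemma acyclic_familyD:
  fixes \<gamma> :: "'n::finite set \<Rightarrow> 'k::field"
  assumes "acyclic_family TYPE('k) D j" "chain j \<gamma>" "\<And>S. S \<notin> D \<Longrightarrow> \<gamma> S = 0"
    "\<And>S. S \<in> D \<Longrightarrow> bdry (\<lambda>_. 1) \<gamma> S = 0"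
  obtains \<beta> where "chain (Suc j) \<beta>" "\<And>S. S \<notin> D \<Longrightarrow> \<beta> S = 0"
    "\<And>S. S \<in> D \<Longrightarrow> \<gamma> S = bdry (\<lambda>_. 1) \<beta> S"
  using assms unfolding acyclic_family_def by blast

text \<open>
  The sets \<open>S\<close> for which \<open>x\<^sup>a\<close> divided by the product of \<open>S\<close> is a monomial outside the ideal: a
  basis of the part of multidegree \<open>a\<close> of the Koszul complex, where \<open>e\<^sub>S\<close> has the multidegree of
  the product of \<open>S\<close>. Among the subsets of the support of \<open>a\<close> they form the complement of the
  upper Koszul complex of the ideal.
\<close>

definition koszul_support :: "('n \<Rightarrow> nat) set \<Rightarrow> ('n \<Rightarrow> nat) \<Rightarrow> 'n set set" where
  "koszul_support U a = {S. ind S \<le> a \<and> (\<lambda>k. a k - ind S k) \<notin> U}"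

lemma koszul_support_insert:
  assumes "up_closed U" "S \<in> koszul_support U a" "1 \<le> a k"
  shows "insert k S \<in> koszul_support U a"
proof -
  have "(\<lambda>l. a l - ind (insert k S) l) \<le> (\<lambda>l. a l - ind S l)"
    by (auto simp: le_fun_def ind_def)
  then show ?thesis
    using assms by (auto simp: koszul_support_def up_closed_def ind_le_iff)
qed

lemma koszul_support_insertD: "insert k S \<in> koszul_support U a \<Longrightarrow> 1 \<le> a k"
  by (auto simp: koszul_support_def ind_le_iff)

text \<open>
  The part of a chain in multidegree \<open>a\<close>: since \<open>e\<^sub>S\<close> itself has multidegree \<open>chi S\<close>, the
  coefficient is taken at \<open>a - chi S\<close>.
\<close>

definition component ::
    "('n \<Rightarrow>\<^sub>0 nat) \<Rightarrow> ('n::finite set \<Rightarrow> ('n, 'k::field) mpoly) \<Rightarrow> 'n set \<Rightarrow> 'k" where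
  "component a c S = (if ind S \<le> Poly_Mapping.lookup a then Poly_Mapping.lookup (c S) (a - chi S) else 0)"

lemma lookup_koszul_sign_mult:
  fixes f :: "('n, 'k::field) mpoly"
  shows "Poly_Mapping.lookup (koszul_sign i S * f) e = koszul_sign i S * Poly_Mapping.lookup f e"
  by (simp add: koszul_sign_def minus_one_power_iff)

text \<open>
  The factor \<open>x\<^sub>i\<close> makes up for the loss of \<open>i\<close> from the set, so the differential preserves the
  multidegree.
\<close>

lemma lookup_bdry:
  fixes c :: "'n::finite set \<Rightarrow> ('n, 'k::field) mpoly"
  assumes "ind S \<le> Poly_Mapping.lookup a"
  shows "Poly_Mapping.lookup (bdry (\<lambda>i. monom_of (var i)) c S) (a - chi S) = bdry (\<lambda>_. 1) (component a c) S"
  unfolding bdry_def lookup_sum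
proof (rule sum.cong[OF refl])
  fix i assume i: "i \<in> - S"
  have 1: "Poly_Mapping.lookup (var i) \<le> Poly_Mapping.lookup (a - chi S) \<longleftrightarrow> ind (insert i S) \<le> Poly_Mapping.lookup a"
    using i assms by (auto simp: le_fun_def var_def lookup_single when_def lookup_minus ind_def)
  have 2: "a - chi S - var i = a - chi (insert i S)"
    using i by (intro poly_mapping_eqI) (auto simp: var_def lookup_single when_def lookup_minus ind_def)
  show "Poly_Mapping.lookup (koszul_sign i S * monom_of (var i) * c (insert i S)) (a - chi S) =
      koszul_sign i S * 1 * component a c (insert i S)"
    unfolding mult.assoc lookup_koszul_sign_mult monom_of_def lookup_monomial_mult 1 2
    by (simp add: component_def)
qed

text \<open>
  Adding a variable leads from a set of the support to another one or to a set whose product does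
  not divide \<open>x\<^sup>a\<close>, so the remaining values of a chain are irrelevant.
\<close>

lemma bdry_support_cong:
  assumes "up_closed U" "S \<in> koszul_support U a"
    and "\<And>T. T \<in> koszul_support U a \<Longrightarrow> \<gamma> T = \<delta> T"
    and "\<And>T. \<not> ind T \<le> a \<Longrightarrow> \<gamma> T = \<delta> T"
  shows "bdry x \<gamma> S = bdry x \<delta> S"
  unfolding bdry_def
proof (rule sum.cong[OF refl])
  fix i assume "i \<in> - S"
  have "\<gamma> (insert i S) = \<delta> (insert i S)"
  proof (cases "1 \<le> a i")
    case True
    then show ?thesis using assms(3) koszul_support_insert[OF assms(1,2)] by blast
  next
    case False
    then show ?thesis using assms(4) by (auto simp: ind_le_iff)
  qed
  then show "koszul_sign i S * x i * \<gamma> (insert i S) = koszul_sign i S * x i * \<delta> (insert i S)"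
    by simp
qed

lemma add_chi_diff: "e + chi S - chi S = e"
  by (rule poly_mapping_eqI) (simp add: lookup_add lookup_minus)

lemma diff_chi_add: "ind S \<le> Poly_Mapping.lookup a \<Longrightarrow> a - chi S + chi S = a"
  by (rule poly_mapping_eqI) (simp add: lookup_add lookup_minus le_fun_def)

lemma ind_le_add_chi: "ind S \<le> Poly_Mapping.lookup (e + chi S)"
  by (simp add: le_fun_def lookup_add)

lemma in_koszul_support_add_chi: "S \<in> koszul_support U (Poly_Mapping.lookup (e + chi S)) \<longleftrightarrow> Poly_Mapping.lookup e \<notin> U"
proof -
  have "(\<lambda>k. Poly_Mapping.lookup (e + chi S) k - ind S k) = Poly_Mapping.lookup e" by (simp add: lookup_add)
  then show ?thesis using ind_le_add_chi[of S e] by (simp add: koszul_support_def)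
qed

lemma lookup_diff_chi: "Poly_Mapping.lookup (a - chi S) = (\<lambda>k. Poly_Mapping.lookup a k - ind S k)"
  by (simp add: lookup_minus fun_eq_iff)

text \<open>
  A chain is the sum of its components, finitely many of which are nonzero, and cycles and
  boundaries modulo a monomial ideal can be tested on components.
\<close>

theorem koszul_exact_mono_set_iff:
  fixes U :: "('n::finite \<Rightarrow> nat) set"
  assumes U: "up_closed U"
  shows "koszul_exact (\<lambda>i. monom_of (var i) :: ('n, 'k::field) mpoly) (mono_set U) j \<longleftrightarrow>
    (\<forall>a :: 'n \<Rightarrow>\<^sub>0 nat. acyclic_family TYPE('k) (koszul_support U (Poly_Mapping.lookup a)) j)"
    (is "koszul_exact ?x _ _ \<longleftrightarrow> _")
proof
  assume ex: "koszul_exact ?x (mono_set U) j"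
  show "\<forall>a :: 'n \<Rightarrow>\<^sub>0 nat. acyclic_family TYPE('k) (koszul_support U (Poly_Mapping.lookup a)) j"
    unfolding acyclic_family_def
  proof (intro allI impI, elim conjE)
    fix a :: "'n \<Rightarrow>\<^sub>0 nat" and \<gamma> :: "'n set \<Rightarrow> 'k"
    let ?D = "koszul_support U (Poly_Mapping.lookup a)"
    assume \<gamma>: "chain j \<gamma>" "\<forall>S. S \<notin> ?D \<longrightarrow> \<gamma> S = 0" "\<forall>S\<in>?D. bdry (\<lambda>_. 1) \<gamma> S = 0"
    define c :: "'n set \<Rightarrow> ('n, 'k) mpoly" where
      "c S = Poly_Mapping.single (a - chi S) (\<gamma> S)" for S
    have comp: "component a' c S = (if a' = a then \<gamma> S else 0)" for a' S
    proof (cases "S \<in> ?D")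
      case True
      then have S: "ind S \<le> Poly_Mapping.lookup a" by (simp add: koszul_support_def)
      have "a' = a" if "ind S \<le> Poly_Mapping.lookup a'" "a - chi S = a' - chi S"
        using diff_chi_add[OF S] diff_chi_add[OF that(1)] that(2) by metis
      then show ?thesis using S by (auto simp: component_def c_def lookup_single when_def)
    qed (use \<gamma>(2) in \<open>simp add: component_def c_def\<close>)
    have "bdry ?x c S \<in> mono_set U" for S
      unfolding mono_set_iff
    proof (intro allI impI)
      fix e assume e: "Poly_Mapping.lookup e \<notin> U"
      let ?a = "e + chi S"
      have "Poly_Mapping.lookup (bdry ?x c S) e = bdry (\<lambda>_. 1) (component ?a c) S"
        using lookup_bdry[OF ind_le_add_chi[of S e], of c] by (simp add: add_chi_diff)
      also have "\<dots> = 0"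
      proof (cases "?a = a")
        case True
        then have "component ?a c = \<gamma>" by (auto simp: comp)
        moreover have "S \<in> ?D" using e in_koszul_support_add_chi[of S U e] True by simp
        ultimately show ?thesis using \<gamma>(3) by simp
      next
        case False
        then have "component ?a c = (\<lambda>_. 0)" by (auto simp: comp)
        then show ?thesis by simp
      qed
      finally show "Poly_Mapping.lookup (bdry ?x c S) e = 0" .
    qed
    moreover have "chain j c" using \<gamma>(1) by (simp add: chain_def c_def)
    ultimately obtain b where b: "chain (Suc j) b" "\<And>S. c S - bdry ?x b S \<in> mono_set U"
      using ex unfolding koszul_exact_def by blast
    define \<beta> where "\<beta> S = (if S \<in> ?D then component a b S else 0)" for S
    have "chain (Suc j) \<beta>" using b(1) by (simp add: chain_def \<beta>_def component_def)
    moreover have "\<gamma> S = bdry (\<lambda>_. 1) \<beta> S" if S: "S \<in> ?D" for S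
    proof -
      have S': "ind S \<le> Poly_Mapping.lookup a" "Poly_Mapping.lookup (a - chi S) \<notin> U"
        using S by (simp_all add: koszul_support_def lookup_diff_chi)
      have "bdry (\<lambda>_. 1) \<beta> S = bdry (\<lambda>_. 1) (component a b) S"
        using U S by (rule bdry_support_cong) (auto simp: \<beta>_def component_def koszul_support_def)
      also have "\<dots> = Poly_Mapping.lookup (bdry ?x b S) (a - chi S)" using lookup_bdry[OF S'(1), of b] by simp
      also have "\<dots> = Poly_Mapping.lookup (c S) (a - chi S)"
        using b(2)[of S] S'(2) by (simp add: mono_set_iff lookup_minus)
      also have "\<dots> = \<gamma> S" by (simp add: c_def)
      finally show ?thesis by simp
    qed
    ultimately show "\<exists>\<beta>. chain (Suc j) \<beta> \<and> (\<forall>S. S \<notin> ?D \<longrightarrow> \<beta> S = 0) \<and>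
        (\<forall>S\<in>?D. \<gamma> S = bdry (\<lambda>_. 1) \<beta> S)"
      by (intro exI[of _ \<beta>]) (simp add: \<beta>_def)
  qed
next
  assume ac: "\<forall>a :: 'n \<Rightarrow>\<^sub>0 nat. acyclic_family TYPE('k) (koszul_support U (Poly_Mapping.lookup a)) j"
  show "koszul_exact ?x (mono_set U) j"
    unfolding koszul_exact_def
  proof (intro allI impI, elim conjE)
    fix c :: "'n set \<Rightarrow> ('n, 'k) mpoly"
    assume c: "chain j c" "\<forall>S. bdry ?x c S \<in> mono_set U"
    let ?D = "\<lambda>a. koszul_support U (Poly_Mapping.lookup a)"
    define \<gamma> where "\<gamma> a S = (if S \<in> ?D a then component a c S else 0)" for a S
    have \<gamma>_bdry: "bdry (\<lambda>_. 1) (\<gamma> a) S = Poly_Mapping.lookup (bdry ?x c S) (a - chi S)" if S: "S \<in> ?D a" for a S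
    proof -
      have "bdry (\<lambda>_. 1) (\<gamma> a) S = bdry (\<lambda>_. 1) (component a c) S"
        using U S by (rule bdry_support_cong) (auto simp: \<gamma>_def component_def koszul_support_def)
      also have "\<dots> = Poly_Mapping.lookup (bdry ?x c S) (a - chi S)"
        using S lookup_bdry[of S a c] by (simp add: koszul_support_def)
      finally show ?thesis .
    qed
    have "\<exists>\<beta>. chain (Suc j) \<beta> \<and> (\<forall>S. S \<notin> ?D a \<longrightarrow> \<beta> S = 0) \<and>
        (\<forall>S\<in>?D a. \<gamma> a S = bdry (\<lambda>_. 1) \<beta> S) \<and> ((\<forall>S. \<gamma> a S = 0) \<longrightarrow> (\<forall>S. \<beta> S = 0))" for a
    proof (cases "\<forall>S. \<gamma> a S = 0")
      case True
      then show ?thesis by (intro exI[of _ "\<lambda>_. 0"]) (simp add: chain_def)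
    next
      case False
      have cyc: "bdry (\<lambda>_. 1) (\<gamma> a) S = 0" if "S \<in> ?D a" for S
        using that c(2) by (simp add: \<gamma>_bdry koszul_support_def mono_set_iff lookup_diff_chi)
      have ch: "chain j (\<gamma> a)" using c(1) by (simp add: chain_def \<gamma>_def component_def)
      from ac have "acyclic_family TYPE('k) (?D a) j" by blast
      moreover have "\<gamma> a S = 0" if "S \<notin> ?D a" for S using that by (simp add: \<gamma>_def)
      ultimately obtain \<beta> where "chain (Suc j) \<beta>" "\<And>S. S \<notin> ?D a \<Longrightarrow> \<beta> S = 0"
          "\<And>S. S \<in> ?D a \<Longrightarrow> \<gamma> a S = bdry (\<lambda>_. 1) \<beta> S"
        using acyclic_familyD[OF _ ch _ cyc] by blast
      then show ?thesis using False by blast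
    qed
    then obtain \<beta> where \<beta>: "\<And>a. chain (Suc j) (\<beta> a)" "\<And>a S. S \<notin> ?D a \<Longrightarrow> \<beta> a S = 0"
      "\<And>a S. S \<in> ?D a \<Longrightarrow> \<gamma> a S = bdry (\<lambda>_. 1) (\<beta> a) S"
      "\<And>a S. (\<And>S. \<gamma> a S = 0) \<Longrightarrow> \<beta> a S = 0"
      by metis
    define Fin where "Fin = (\<Union>S. (\<lambda>e. e + chi S) ` Poly_Mapping.keys (c S))"
    have "finite Fin" by (simp add: Fin_def)
    have Fin: "\<beta> a S = 0" if "a \<notin> Fin" for a S
    proof (rule \<beta>(4))
      fix T
      show "\<gamma> a T = 0"
      proof (rule ccontr)
        assume "\<gamma> a T \<noteq> 0"
        then have "ind T \<le> Poly_Mapping.lookup a" "a - chi T \<in> Poly_Mapping.keys (c T)"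
          by (auto simp: \<gamma>_def component_def in_keys_iff split: if_splits)
        then have "a \<in> Fin" unfolding Fin_def using diff_chi_add[of T a] by force
        then show False using that by simp
      qed
    qed
    \<comment> \<open>The chain whose component in each multidegree \<open>a\<close> is \<open>\<beta> a\<close>.\<close>
    define b :: "'n set \<Rightarrow> ('n, 'k) mpoly" where
      "b S = Abs_poly_mapping (\<lambda>e. \<beta> (e + chi S) S)" for S
    have lookup_b: "Poly_Mapping.lookup (b S) e = \<beta> (e + chi S) S" for S e
    proof -
      have "{e. \<beta> (e + chi S) S \<noteq> 0} \<subseteq> (\<lambda>a. a - chi S) ` Fin"
      proof
        fix e assume "e \<in> {e. \<beta> (e + chi S) S \<noteq> 0}"
        then have "e + chi S \<in> Fin" using Fin by auto
        then show "e \<in> (\<lambda>a. a - chi S) ` Fin" using add_chi_diff[of e S] by force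
      qed
      then have "finite {e. \<beta> (e + chi S) S \<noteq> 0}"
        using \<open>finite Fin\<close> finite_surj by blast
      then show ?thesis by (simp add: b_def)
    qed
    have comp_b: "component a b = \<beta> a" for a
      using \<beta>(2)[of _ a] by (auto simp: component_def lookup_b diff_chi_add koszul_support_def)
    have "chain (Suc j) b"
      unfolding chain_def
      using \<beta>(1) by (auto simp: chain_def lookup_b intro!: poly_mapping_eqI)
    moreover have "c S - bdry ?x b S \<in> mono_set U" for S
      unfolding mono_set_iff
    proof (intro allI impI)
      fix e assume e: "Poly_Mapping.lookup e \<notin> U"
      let ?a = "e + chi S"
      have S: "S \<in> ?D ?a" using e by (simp add: in_koszul_support_add_chi)
      have "Poly_Mapping.lookup (bdry ?x b S) e = bdry (\<lambda>_. 1) (\<beta> ?a) S"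
        using lookup_bdry[OF ind_le_add_chi[of S e], of b] by (simp add: add_chi_diff comp_b)
      also have "\<dots> = \<gamma> ?a S" using \<beta>(3)[OF S] by simp
      also have "\<dots> = Poly_Mapping.lookup (c S) e" using S ind_le_add_chi[of S e] by (simp add: \<gamma>_def component_def add_chi_diff)
      finally show "Poly_Mapping.lookup (c S - bdry ?x b S) e = 0" by (simp add: lookup_minus)
    qed
    ultimately show "\<exists>b. chain (Suc j) b \<and> (\<forall>S. c S - bdry ?x b S \<in> mono_set U)" by blast
  qed
qed

section \<open>Slices of an exponent set\<close>

text \<open>
  The member \<open>I\<^sub>t\<close> of the chain: exponents that belong to \<open>U\<close> once their \<open>i\<close>-th coordinate is set
  to \<open>t\<close>, whatever that coordinate was.
\<close>

definition slice :: "'n \<Rightarrow> nat \<Rightarrow> ('n \<Rightarrow> nat) set \<Rightarrow> ('n \<Rightarrow> nat) set" where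
  "slice i t U = {w. w(i := t) \<in> U}"

text \<open>
  The exponent \<open>a\<close> reduced by \<open>S\<close> away from \<open>i\<close>; zero stands in for the \<open>i\<close>-th coordinate, which
  slices ignore.
\<close>

definition rest :: "'n \<Rightarrow> ('n \<Rightarrow> nat) \<Rightarrow> 'n set \<Rightarrow> 'n \<Rightarrow> nat" where
  "rest i a S = (\<lambda>k. a k - ind S k)(i := 0)"

lemma rest_update [simp]: "rest i (a(i := t)) S = rest i a S"
  by (auto simp: rest_def)

lemma rest_insert [simp]: "rest i a (insert i S) = rest i a S"
  by (auto simp: rest_def ind_def)

text \<open>
  Only the slices at \<open>a\<^sub>i\<close> and, for the sets containing \<open>i\<close>, at \<open>a\<^sub>i - 1\<close> matter.
\<close>

lemma koszul_support_slice:
  "S \<in> koszul_support U a \<longleftrightarrow>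
     ind S \<le> a \<and> rest i a S \<notin> slice i (a i - of_bool (i \<in> S)) U"
proof -
  have "(rest i a S)(i := a i - of_bool (i \<in> S)) = (\<lambda>k. a k - ind S k)"
    by (auto simp: rest_def ind_def)
  then show ?thesis by (simp add: koszul_support_def slice_def)
qed

text \<open>
  Inserting \<open>i\<close>, with its sign, is a contracting homotopy.
\<close>

lemma acyclic_cone:
  assumes D: "\<And>S. i \<notin> S \<Longrightarrow> insert i S \<in> D \<longleftrightarrow> S \<in> D"
  shows "acyclic_family TYPE('k::field) (D :: 'n::finite set set) j"
  unfolding acyclic_family_def
proof (intro allI impI, elim conjE)
  fix \<gamma> :: "'n set \<Rightarrow> 'k"
  assume \<gamma>: "chain j \<gamma>" "\<forall>S. S \<notin> D \<longrightarrow> \<gamma> S = 0" "\<forall>S\<in>D. bdry (\<lambda>_. 1) \<gamma> S = 0"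
  define \<beta> where
    "\<beta> S = (if i \<in> S then koszul_sign i (S - {i}) * \<gamma> (S - {i}) else 0)" for S
  have \<beta>i: "\<beta> (insert i T) = koszul_sign i T * \<gamma> T" if "i \<notin> T" for T
    using that by (simp add: \<beta>_def)
  have "chain (Suc j) \<beta>"
    unfolding chain_def
  proof (intro allI impI)
    fix S :: "'n set" assume "card S \<noteq> Suc j"
    then have "i \<in> S \<Longrightarrow> card (S - {i}) \<noteq> j" using card_Suc_Diff1[of S i] by auto
    then show "\<beta> S = 0" using \<gamma>(1) by (simp add: \<beta>_def chain_def)
  qed
  moreover have "\<beta> S = 0" if "S \<notin> D" for S
  proof (cases "i \<in> S")
    case True
    then have "S - {i} \<notin> D" using D[of "S - {i}"] that by (simp add: insert_absorb)
    then show ?thesis using \<gamma>(2) by (simp add: \<beta>_def)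
  qed (simp add: \<beta>_def)
  moreover have "\<gamma> S = bdry (\<lambda>_. 1) \<beta> S" if "S \<in> D" for S
  proof (cases "i \<in> S")
    case False
    have "bdry (\<lambda>_. 1) \<beta> S = (\<Sum>k\<in>-S. if k = i then \<gamma> S else 0)"
      unfolding bdry_def
    proof (rule sum.cong[OF refl])
      fix k assume "k \<in> - S"
      have "koszul_sign i S * (koszul_sign i S * \<gamma> S) = \<gamma> S"
        by (simp flip: mult.assoc)
      then show "koszul_sign k S * 1 * \<beta> (insert k S) = (if k = i then \<gamma> S else 0)"
        using False \<beta>i[OF False] by (auto simp: \<beta>_def)
    qed
    then show ?thesis using False by simp
  next
    case True
    define T where "T = S - {i}"
    have S: "S = insert i T" "i \<notin> T" using True by (auto simp: T_def)
    have "T \<in> D" using D[of T] S that by simp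
    have "- T = insert i (- S)" "i \<notin> - S" using S by auto
    then have "bdry (\<lambda>_. 1) \<gamma> T =
        koszul_sign i T * \<gamma> S + (\<Sum>k\<in>-S. koszul_sign k T * \<gamma> (insert k T))"
      unfolding bdry_def S(1)[symmetric] by (simp add: S(1)[symmetric])
    then have cyc: "(\<Sum>k\<in>-S. koszul_sign k T * \<gamma> (insert k T)) = - (koszul_sign i T * \<gamma> S)"
      using \<gamma>(3) \<open>T \<in> D\<close> by (simp add: eq_neg_iff_add_eq_0 add.commute)
    have "bdry (\<lambda>_. 1) \<beta> S =
        (\<Sum>k\<in>-S. - koszul_sign i T * (koszul_sign k T * \<gamma> (insert k T)))"
      unfolding bdry_def
    proof (rule sum.cong[OF refl])
      fix k assume k: "k \<in> - S"
      then have k': "k \<noteq> i" "k \<notin> T" using S by auto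
      have ins: "insert k S = insert i (insert k T)" using S by auto
      have b: "\<beta> (insert k S) = koszul_sign i (insert k T) * \<gamma> (insert k T)"
        unfolding ins using S(2) k' by (intro \<beta>i) auto
      have sw: "koszul_sign k S * koszul_sign i (insert k T) =
          - (koszul_sign i T * koszul_sign k T :: 'k)"
        using koszul_sign_swap[OF k'(1,2) S(2)] by (simp add: S(1) mult.commute)
      have "koszul_sign k S * 1 * \<beta> (insert k S) =
          (koszul_sign k S * koszul_sign i (insert k T)) * \<gamma> (insert k T)"
        by (simp add: b mult.assoc)
      then show "koszul_sign k S * 1 * \<beta> (insert k S) =
          - koszul_sign i T * (koszul_sign k T * \<gamma> (insert k T))"
        by (simp add: sw mult.assoc)
    qed
    also have "\<dots> = - koszul_sign i T * - (koszul_sign i T * \<gamma> S)"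
      unfolding sum_distrib_left[symmetric] cyc ..
    also have "\<dots> = \<gamma> S" by (simp flip: mult.assoc)
    finally show ?thesis by simp
  qed
  ultimately show "\<exists>\<beta>. chain (Suc j) \<beta> \<and> (\<forall>S. S \<notin> D \<longrightarrow> \<beta> S = 0) \<and>
      (\<forall>S\<in>D. \<gamma> S = bdry (\<lambda>_. 1) \<beta> S)" by blast
qed

text \<open>
  Where two consecutive slices agree, membership of \<open>S\<close> does not depend on whether \<open>i \<in> S\<close>.
\<close>

lemma acyclic_repeated_slice:
  fixes a :: "'n::finite \<Rightarrow> nat"
  assumes "1 \<le> a i" "slice i (a i) U = slice i (a i - 1) U"
  shows "acyclic_family TYPE('k::field) (koszul_support U a) j"
proof (rule acyclic_cone[of i])
  fix S assume "i \<notin> S"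
  then show "insert i S \<in> koszul_support U a \<longleftrightarrow> S \<in> koszul_support U a"
    using assms by (auto simp: koszul_support_slice[where i = i] ind_le_iff)
qed

lemma koszul_support_eq_slices:
  assumes "a i = 0 \<longleftrightarrow> s = 0" "slice i (a i) V = slice i s U"
    and "slice i (a i - 1) V = slice i (s - 1) U"
  shows "koszul_support V a = koszul_support U (a(i := s))"
proof -
  have "S \<in> koszul_support V a \<longleftrightarrow> S \<in> koszul_support U (a(i := s))" for S
  proof -
    have "1 \<le> (a(i := s)) k \<longleftrightarrow> 1 \<le> a k" for k using assms(1) by (cases "k = i") force+
    then have "ind S \<le> a \<longleftrightarrow> ind S \<le> a(i := s)" by (simp only: ind_le_iff)
    then show ?thesis using assms(2,3)
      by (cases "i \<in> S") (simp_all add: koszul_support_slice[where i = i])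
  qed
  then show ?thesis by blast
qed

text \<open>
  Vanishing, in all multidegrees, of the \<open>j\<close>-th Koszul homology of the quotient by the monomial
  ideal with exponent set \<open>U\<close>.
\<close>

definition support_acyclic :: "'k::field itself \<Rightarrow> ('n::finite \<Rightarrow> nat) set \<Rightarrow> nat \<Rightarrow> bool" where
  "support_acyclic K U j \<longleftrightarrow> (\<forall>a. acyclic_family K (koszul_support U a) j)"

text \<open>
  According to the alternative in the premise, a multidegree contributes a cone or the same family
  of sets as some multidegree does for \<open>U\<close>. The condition on zero keeps apart the bottom slice,
  which has no predecessor; there truncated subtraction turns the last equation into the one
  before it.
\<close>

lemma support_acyclic_reslice:
  assumes U: "support_acyclic TYPE('k::field) U j"
    and steps: "\<And>t. (1 \<le> t \<and> slice i t V = slice i (t - 1) V) \<or>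
      (\<exists>s. (t = 0 \<longleftrightarrow> s = 0) \<and> slice i t V = slice i s U \<and> slice i (t - 1) V = slice i (s - 1) U)"
  shows "support_acyclic TYPE('k) V j"
  unfolding support_acyclic_def
proof
  fix a
  from steps[of "a i"] show "acyclic_family TYPE('k) (koszul_support V a) j"
  proof
    assume "1 \<le> a i \<and> slice i (a i) V = slice i (a i - 1) V"
    then show ?thesis using acyclic_repeated_slice by blast
  next
    assume "\<exists>s. (a i = 0 \<longleftrightarrow> s = 0) \<and> slice i (a i) V = slice i s U \<and>
      slice i (a i - 1) V = slice i (s - 1) U"
    then obtain s where "a i = 0 \<longleftrightarrow> s = 0" "slice i (a i) V = slice i s U"
        "slice i (a i - 1) V = slice i (s - 1) U" by (elim exE conjE)
    from koszul_support_eq_slices[of a i, OF this] show ?thesis using U by (simp add: support_acyclic_def)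
  qed
qed

text \<open>
  Leaving out repetitions (here of slice \<open>r - 1\<close>) removes only constant pairs of consecutive
  slices; the other pairs of \<open>U\<close> and \<open>V\<close> correspond to each other.
\<close>

theorem support_acyclic_remove_repeated_slices:
  assumes r: "1 \<le> r"
    and low: "\<And>t. t < r \<Longrightarrow> slice i t V = slice i t U"
    and high: "\<And>t. r \<le> t \<Longrightarrow> slice i t V = slice i (t + m) U"
    and rep: "\<And>t. r - 1 \<le> t \<Longrightarrow> t \<le> r - 1 + m \<Longrightarrow> slice i t U = slice i (r - 1) U"
  shows "support_acyclic TYPE('k::field) V j \<longleftrightarrow> support_acyclic TYPE('k) U j"
proof
  assume "support_acyclic TYPE('k) U j"
  then show "support_acyclic TYPE('k) V j"
  proof (rule support_acyclic_reslice[where i = i])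
    fix t
    let ?s = "if t < r then t else t + m"
    have "slice i (t - 1) V = slice i (?s - 1) U"
    proof (cases "t \<le> r")
      case True
      then show ?thesis using low[of "t - 1"] rep[of "r - 1 + m"] r by (cases "t = r") auto
    next
      case False
      then show ?thesis using high[of "t - 1"] by (simp add: Suc_diff_le)
    qed
    moreover have "slice i t V = slice i ?s U" using low high by simp
    ultimately show "(1 \<le> t \<and> slice i t V = slice i (t - 1) V) \<or>
      (\<exists>s. (t = 0 \<longleftrightarrow> s = 0) \<and> slice i t V = slice i s U \<and> slice i (t - 1) V = slice i (s - 1) U)"
      using r by (intro disjI2 exI[of _ ?s]) auto
  qed
next
  assume "support_acyclic TYPE('k) V j"
  then show "support_acyclic TYPE('k) U j"
  proof (rule support_acyclic_reslice[where i = i])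
    fix t
    show "(1 \<le> t \<and> slice i t U = slice i (t - 1) U) \<or>
      (\<exists>s. (t = 0 \<longleftrightarrow> s = 0) \<and> slice i t U = slice i s V \<and> slice i (t - 1) U = slice i (s - 1) V)"
    proof (cases "r \<le> t \<and> t \<le> r - 1 + m")
      case True
      then show ?thesis using rep[of t] rep[of "t - 1"] r by auto
    next
      case False
      let ?s = "if t < r then t else t - m"
      have "slice i t U = slice i ?s V" using low[of t] high[of "t - m"] False r by auto
      moreover have "slice i (t - 1) U = slice i (?s - 1) V"
      proof (cases "t < r")
        case True
        then show ?thesis using low[of "t - 1"] by simp
      next
        case ge: False
        show ?thesis
        proof (cases "t = r + m")
          case True
          then show ?thesis using low[of "r - 1"] rep[of "r - 1 + m"] r by auto
        next
          case neq: False
          then have "r \<le> t - 1 - m" "t - 1 - m + m = t - 1" using ge False by auto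
          then show ?thesis using high[of "t - 1 - m"] ge by (simp add: diff_right_commute)
        qed
      qed
      ultimately show ?thesis using False r by (intro disjI2 exI[of _ ?s]) auto
    qed
  qed
qed

section \<open>Deleting a slice\<close>

lemma bdry_cong:
  assumes "\<And>k. k \<notin> S \<Longrightarrow> \<gamma> (insert k S) = \<delta> (insert k S)"
  shows "bdry x \<gamma> S = bdry x \<delta> S"
  unfolding bdry_def using assms by (intro sum.cong refl) simp

text \<open>
  Let \<open>X \<supseteq> Y \<supseteq> Z\<close> be families of sets avoiding \<open>i\<close>, and write \<open>Z \<union> i\<cdot>Y\<close> for \<open>Z\<close> together with the
  sets \<open>{i} \<union> S\<close> for \<open>S \<in> Y\<close>. The model case is \<open>D1 = Y \<union> i\<cdot>X\<close>, \<open>D2 = Z \<union> i\<cdot>Y\<close> and \<open>D3 = Z \<union> i\<cdot>X\<close>,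
  where all members are subsets of \<open>W\<close> and adding elements of \<open>W\<close> does not leave the families.
  Their homology is that of the relative complexes of the pairs \<open>(X, Y)\<close>, \<open>(Y, Z)\<close> and \<open>(X, Z)\<close>,
  up to a shift, so acyclicity of \<open>D1\<close> and \<open>D2\<close> gives that of \<open>D3\<close>. The proof first restricts a
  cycle to \<open>D2\<close>, where it bounds; what remains lives on \<open>i\<cdot>X\<close> outside \<open>i\<cdot>Y\<close>, so it is a cycle of
  \<open>D1\<close> as well and bounds there.
\<close>

lemma acyclic_splice:
  fixes D1 D2 D3 :: "'n::finite set set"
  assumes up2: "\<And>S k. S \<in> D2 \<Longrightarrow> k \<in> W \<Longrightarrow> insert k S \<in> D2"
    and up3: "\<And>S k. S \<in> D3 \<Longrightarrow> k \<in> W \<Longrightarrow> insert k S \<in> D3"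
    and sub1: "\<And>S k. insert k S \<in> D1 \<Longrightarrow> k \<in> W"
    and sub2: "\<And>S k. insert k S \<in> D2 \<Longrightarrow> k \<in> W"
    and sub3: "\<And>S k. insert k S \<in> D3 \<Longrightarrow> k \<in> W"
    and avoids: "\<And>S. i \<notin> S \<Longrightarrow> S \<in> D2 \<longleftrightarrow> S \<in> D3" "\<And>S. i \<notin> S \<Longrightarrow> S \<in> D3 \<Longrightarrow> S \<in> D1"
    and contains: "\<And>S. i \<in> S \<Longrightarrow> S \<in> D1 \<longleftrightarrow> S \<in> D3" "\<And>S. i \<in> S \<Longrightarrow> S \<in> D2 \<Longrightarrow> S \<in> D3"
    and link: "\<And>S. i \<notin> S \<Longrightarrow> S \<in> D1 \<Longrightarrow> insert i S \<in> D2"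
    and ac1: "acyclic_family TYPE('k::field) D1 j"
    and ac2: "acyclic_family TYPE('k) D2 j"
  shows "acyclic_family TYPE('k) D3 j"
  unfolding acyclic_family_def
proof (intro allI impI, elim conjE)
  fix \<gamma> :: "'n set \<Rightarrow> 'k"
  assume \<gamma>: "chain j \<gamma>" "\<forall>S. S \<notin> D3 \<longrightarrow> \<gamma> S = 0" "\<forall>S\<in>D3. bdry (\<lambda>_. 1) \<gamma> S = 0"
  have D23: "S \<in> D2 \<Longrightarrow> S \<in> D3" for S using avoids(1) contains(2) by blast
  have D31: "S \<in> D3 \<Longrightarrow> S \<in> D1" for S using avoids(2) contains(1) by blast
  define \<gamma>2 where "\<gamma>2 S = (if S \<in> D2 then \<gamma> S else 0)" for S
  have "bdry (\<lambda>_. 1) \<gamma>2 S = 0" if S: "S \<in> D2" for S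
  proof -
    have "\<gamma>2 (insert k S) = \<gamma> (insert k S)" for k
      using \<gamma>(2) up2[OF S, of k] sub3[of k S] unfolding \<gamma>2_def by metis
    then have "bdry (\<lambda>_. 1) \<gamma>2 S = bdry (\<lambda>_. 1) \<gamma> S"
      by (intro bdry_cong) blast
    then show ?thesis using \<gamma>(3) D23[OF S] by simp
  qed
  moreover have "chain j \<gamma>2" using \<gamma>(1) by (simp add: chain_def \<gamma>2_def)
  moreover have "\<gamma>2 S = 0" if "S \<notin> D2" for S using that by (simp add: \<gamma>2_def)
  ultimately obtain \<beta>2 where \<beta>2: "chain (Suc j) \<beta>2" "\<And>S. S \<notin> D2 \<Longrightarrow> \<beta>2 S = 0"
      "\<And>S. S \<in> D2 \<Longrightarrow> \<gamma>2 S = bdry (\<lambda>_. 1) \<beta>2 S"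
    using acyclic_familyD[OF ac2] by metis
  define \<gamma>3 where "\<gamma>3 S = (if S \<in> D3 then \<gamma> S - bdry (\<lambda>_. 1) \<beta>2 S else 0)" for S
  have \<gamma>3_D2: "\<gamma>3 S = 0" if "S \<in> D2" for S
    using \<beta>2(3)[OF that] that by (simp add: \<gamma>3_def \<gamma>2_def)
  have \<gamma>3_i: "S \<in> D3 \<and> i \<in> S" if "\<gamma>3 S \<noteq> 0" for S
    using that \<gamma>3_D2 avoids(1) unfolding \<gamma>3_def by meson
  have cyc3: "bdry (\<lambda>_. 1) \<gamma>3 S = 0" if S: "S \<in> D3" for S
  proof -
    have "bdry (\<lambda>_. 1) \<gamma>3 S = bdry (\<lambda>_. 1) (\<lambda>S. \<gamma> S - bdry (\<lambda>_. 1) \<beta>2 S) S"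
    proof (rule bdry_cong)
      fix k
      show "\<gamma>3 (insert k S) = \<gamma> (insert k S) - bdry (\<lambda>_. 1) \<beta>2 (insert k S)"
      proof (cases "insert k S \<in> D3")
        case False
        then have "k \<notin> W" using up3[OF S] by blast
        have "insert l (insert k S) \<notin> D2" for l
          using sub2[of k "insert l S"] \<open>k \<notin> W\<close> insert_commute[of k l S] by metis
        then have "bdry (\<lambda>_. 1) \<beta>2 (insert k S) = bdry (\<lambda>_. 1) (\<lambda>_. 0) (insert k S)"
          using \<beta>2(2) by (intro bdry_cong) blast
        then show ?thesis using False \<gamma>(2) by (simp add: \<gamma>3_def)
      qed (simp add: \<gamma>3_def)
    qed
    then show ?thesis using \<gamma>(3) S by (simp add: bdry_diff bdry_bdry)
  qed
  \<comment> \<open>On the part of \<open>D1\<close> avoiding \<open>i\<close> a boundary term of \<open>\<gamma>3\<close> would come from \<open>i\<cdot>Y\<close>, where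
    \<open>\<gamma>3\<close> is zero.\<close>
  have "bdry (\<lambda>_. 1) \<gamma>3 S = 0" if S: "S \<in> D1" for S
  proof (cases "i \<in> S")
    case True
    then show ?thesis using cyc3 contains(1) S by blast
  next
    case False
    have "\<gamma>3 (insert k S) = 0" for k
      using \<gamma>3_i[of "insert k S"] False \<gamma>3_D2 link[OF False S] by (cases "k = i") auto
    then have "bdry (\<lambda>_. 1) \<gamma>3 S = bdry (\<lambda>_. 1) (\<lambda>_. 0) S" by (intro bdry_cong) blast
    then show ?thesis by simp
  qed
  moreover have "chain j \<gamma>3"
    using \<gamma>(1) chain_bdry[OF \<beta>2(1), of "\<lambda>_. 1"] by (simp add: chain_def \<gamma>3_def)
  moreover have "\<gamma>3 S = 0" if "S \<notin> D1" for S using that D31 by (auto simp: \<gamma>3_def)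
  ultimately obtain \<beta>3 where \<beta>3: "chain (Suc j) \<beta>3" "\<And>S. S \<notin> D1 \<Longrightarrow> \<beta>3 S = 0"
      "\<And>S. S \<in> D1 \<Longrightarrow> \<gamma>3 S = bdry (\<lambda>_. 1) \<beta>3 S"
    using acyclic_familyD[OF ac1] by metis
  define \<beta> where "\<beta> S = (if S \<in> D3 then \<beta>2 S + \<beta>3 S else 0)" for S
  have "\<gamma> S = bdry (\<lambda>_. 1) \<beta> S" if S: "S \<in> D3" for S
  proof -
    have "bdry (\<lambda>_. 1) \<beta> S = bdry (\<lambda>_. 1) (\<lambda>S. \<beta>2 S + \<beta>3 S) S"
    proof (rule bdry_cong)
      fix k
      show "\<beta> (insert k S) = \<beta>2 (insert k S) + \<beta>3 (insert k S)"
      proof (cases "insert k S \<in> D3")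
        case False
        then have "k \<notin> W" using up3[OF S] by blast
        then have "insert k S \<notin> D1" "insert k S \<notin> D2" using sub1 sub2 by blast+
        then show ?thesis using False \<beta>2(2) \<beta>3(2) by (simp add: \<beta>_def)
      qed (simp add: \<beta>_def)
    qed
    also have "\<dots> = bdry (\<lambda>_. 1) \<beta>2 S + \<gamma>3 S" using \<beta>3(3) D31[OF S] by (simp add: bdry_add)
    finally show ?thesis using S by (simp add: \<gamma>3_def)
  qed
  moreover have "chain (Suc j) \<beta>" using \<beta>2(1) \<beta>3(1) by (simp add: chain_def \<beta>_def)
  ultimately show "\<exists>\<beta>. chain (Suc j) \<beta> \<and> (\<forall>S. S \<notin> D3 \<longrightarrow> \<beta> S = 0) \<and>
      (\<forall>S\<in>D3. \<gamma> S = bdry (\<lambda>_. 1) \<beta> S)"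
    by (intro exI[of _ \<beta>]) (simp add: \<beta>_def)
qed

text \<open>
  The bottom of the chain, where there is no \<open>X\<close>: now \<open>D1 = Y\<close>, \<open>D2 = Z \<union> i\<cdot>Y\<close> and \<open>D3 = Z\<close>. A
  cycle on \<open>Z\<close> is a cycle of \<open>D2\<close>, where it bounds; the part of the bounding chain on \<open>i\<cdot>Y\<close> is, up
  to signs, a cycle \<open>\<eta>\<close> on \<open>Y\<close>, and replacing it by a chain that bounds \<open>\<eta>\<close> leaves a bounding
  chain on \<open>Z\<close>.
\<close>

lemma acyclic_splice_bottom:
  fixes D1 D2 D3 :: "'n::finite set set"
  assumes up3: "\<And>S k. S \<in> D3 \<Longrightarrow> k \<in> W \<Longrightarrow> insert k S \<in> D3"
    and sub1: "\<And>S k. insert k S \<in> D1 \<Longrightarrow> k \<in> W"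
    and sub2: "\<And>S k. insert k S \<in> D2 \<Longrightarrow> k \<noteq> i \<Longrightarrow> k \<in> W"
    and avoids: "\<And>S. i \<notin> S \<Longrightarrow> S \<in> D2 \<longleftrightarrow> S \<in> D3" "\<And>S. i \<notin> S \<Longrightarrow> S \<in> D3 \<Longrightarrow> S \<in> D1"
    and contains: "\<And>S. i \<in> S \<Longrightarrow> S \<notin> D1" "\<And>S. i \<in> S \<Longrightarrow> S \<notin> D3"
    and link: "\<And>S. i \<notin> S \<Longrightarrow> insert i S \<in> D2 \<longleftrightarrow> S \<in> D1"
    and ac1: "acyclic_family TYPE('k::field) D1 j"
    and ac2: "acyclic_family TYPE('k) D2 j"
  shows "acyclic_family TYPE('k) D3 j"
  unfolding acyclic_family_def
proof (intro allI impI, elim conjE)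
  fix \<gamma> :: "'n set \<Rightarrow> 'k"
  assume \<gamma>: "chain j \<gamma>" "\<forall>S. S \<notin> D3 \<longrightarrow> \<gamma> S = 0" "\<forall>S\<in>D3. bdry (\<lambda>_. 1) \<gamma> S = 0"
  have \<gamma>i: "\<gamma> S = 0" if "i \<in> S" for S using \<gamma>(2) contains(2) that by blast
  have "bdry (\<lambda>_. 1) \<gamma> S = 0" if S: "S \<in> D2" for S
  proof (cases "i \<in> S")
    case True
    then have "bdry (\<lambda>_. 1) \<gamma> S = bdry (\<lambda>_. 1) (\<lambda>_. 0) S"
      by (intro bdry_cong) (simp add: \<gamma>i)
    then show ?thesis by simp
  qed (use \<gamma>(3) avoids(1) S in blast)
  moreover have "\<gamma> S = 0" if "S \<notin> D2" for S
    using \<gamma>(2) \<gamma>i avoids(1) that by blast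
  ultimately obtain \<beta>2 where \<beta>2: "chain (Suc j) \<beta>2" "\<And>S. S \<notin> D2 \<Longrightarrow> \<beta>2 S = 0"
      "\<And>S. S \<in> D2 \<Longrightarrow> \<gamma> S = bdry (\<lambda>_. 1) \<beta>2 S"
    using acyclic_familyD[OF ac2 \<gamma>(1)] by metis
  define \<eta> where "\<eta> S = (if i \<in> S then 0 else koszul_sign i S * \<beta>2 (insert i S))" for S
  have "bdry (\<lambda>_. 1) \<eta> S = 0" if S: "S \<in> D1" for S
  proof -
    have i: "i \<notin> S" using contains(1) S by blast
    have "bdry (\<lambda>_. 1) \<eta> S =
        (\<Sum>k\<in>-insert i S. koszul_sign k S * (koszul_sign i (insert k S) * \<beta>2 (insert k (insert i S))))"
    proof -
      have "- S = insert i (- insert i S)" using i by auto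
      then have "bdry (\<lambda>_. 1) \<eta> S = koszul_sign i S * \<eta> (insert i S) +
          (\<Sum>k\<in>-insert i S. koszul_sign k S * \<eta> (insert k S))"
        unfolding bdry_def by simp
      also have "\<eta> (insert i S) = 0" by (simp add: \<eta>_def)
      also have "(\<Sum>k\<in>-insert i S. koszul_sign k S * \<eta> (insert k S)) =
        (\<Sum>k\<in>-insert i S. koszul_sign k S * (koszul_sign i (insert k S) * \<beta>2 (insert k (insert i S))))"
        using i by (intro sum.cong refl) (auto simp: \<eta>_def insert_commute)
      finally show ?thesis by simp
    qed
    also have "\<dots> = (\<Sum>k\<in>-insert i S. - koszul_sign i S *
        (koszul_sign k (insert i S) * 1 * \<beta>2 (insert k (insert i S))))"
    proof (rule sum.cong[OF refl])
      fix k assume "k \<in> - insert i S"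
      then have sw: "koszul_sign k S * koszul_sign i (insert k S) =
          - (koszul_sign i S * koszul_sign k (insert i S) :: 'k)"
        using i by (intro koszul_sign_swap') auto
      show "koszul_sign k S * (koszul_sign i (insert k S) * \<beta>2 (insert k (insert i S))) =
          - koszul_sign i S * (koszul_sign k (insert i S) * 1 * \<beta>2 (insert k (insert i S)))"
        using sw by (simp flip: mult.assoc)
    qed
    also have "\<dots> = - koszul_sign i S * bdry (\<lambda>_. 1) \<beta>2 (insert i S)"
      by (simp only: bdry_def sum_distrib_left)
    also have "\<dots> = 0" using \<beta>2(3)[of "insert i S"] link[OF i] S \<gamma>i[of "insert i S"] by simp
    finally show ?thesis .
  qed
  moreover have "chain j \<eta>" using \<beta>2(1) by (auto simp: chain_def \<eta>_def)
  moreover have "\<eta> S = 0" if "S \<notin> D1" for S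
    using that link \<beta>2(2) by (auto simp: \<eta>_def)
  ultimately obtain \<beta>3 where \<beta>3: "chain (Suc j) \<beta>3" "\<And>S. S \<notin> D1 \<Longrightarrow> \<beta>3 S = 0"
      "\<And>S. S \<in> D1 \<Longrightarrow> \<eta> S = bdry (\<lambda>_. 1) \<beta>3 S"
    using acyclic_familyD[OF ac1] by metis
  define \<beta> where "\<beta> S = (if S \<in> D3 then \<beta>2 S + \<beta>3 S else 0)" for S
  have "\<gamma> S = bdry (\<lambda>_. 1) \<beta> S" if S: "S \<in> D3" for S
  proof -
    have i: "i \<notin> S" using contains(2) S by blast
    have S1: "S \<in> D1" "S \<in> D2" using avoids[OF i] S by auto
    have C: "- S = insert i (- insert i S)" using i by auto
    have "\<gamma> S = bdry (\<lambda>_. 1) \<beta>2 S" by (rule \<beta>2(3)[OF S1(2)])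
    also have "\<dots> = \<eta> S + (\<Sum>k\<in>-insert i S. koszul_sign k S * \<beta>2 (insert k S))"
      unfolding bdry_def C using i by (simp add: \<eta>_def)
    also have "\<eta> S = bdry (\<lambda>_. 1) \<beta>3 S" by (rule \<beta>3(3)[OF S1(1)])
    also have "\<dots> = (\<Sum>k\<in>-insert i S. koszul_sign k S * \<beta>3 (insert k S))"
      unfolding bdry_def C using \<beta>3(2) contains(1) by simp
    also have "\<dots> + (\<Sum>k\<in>-insert i S. koszul_sign k S * \<beta>2 (insert k S)) =
        (\<Sum>k\<in>-insert i S. koszul_sign k S * \<beta> (insert k S))"
      unfolding sum.distrib[symmetric]
    proof (rule sum.cong[OF refl])
      fix k assume k: "k \<in> - insert i S"
      have "\<beta> (insert k S) = \<beta>2 (insert k S) + \<beta>3 (insert k S)"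
      proof (cases "insert k S \<in> D3")
        case False
        then have "k \<notin> W" using up3[OF S] by blast
        then have "insert k S \<notin> D1" "insert k S \<notin> D2" using sub1 sub2 k by blast+
        then show ?thesis using False \<beta>2(2) \<beta>3(2) by (simp add: \<beta>_def)
      qed (simp add: \<beta>_def)
      then show "koszul_sign k S * \<beta>3 (insert k S) + koszul_sign k S * \<beta>2 (insert k S) =
          koszul_sign k S * \<beta> (insert k S)" by (simp add: distrib_left add.commute)
    qed
    also have "\<dots> = bdry (\<lambda>_. 1) \<beta> S"
      unfolding bdry_def C using contains(2) by (simp add: \<beta>_def)
    finally show ?thesis .
  qed
  moreover have "chain (Suc j) \<beta>" using \<beta>2(1) \<beta>3(1) by (simp add: chain_def \<beta>_def)
  ultimately show "\<exists>\<beta>. chain (Suc j) \<beta> \<and> (\<forall>S. S \<notin> D3 \<longrightarrow> \<beta> S = 0) \<and>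
      (\<forall>S\<in>D3. \<gamma> S = bdry (\<lambda>_. 1) \<beta> S)"
    by (intro exI[of _ \<beta>]) (simp add: \<beta>_def)
qed

text \<open>
  Away from index \<open>p\<close> the pairs of consecutive slices of \<open>V\<close> are pairs of \<open>U\<close>. At index \<open>p\<close> the
  pair of \<open>V\<close> skips a slice of \<open>U\<close>, and the two splicing lemmas apply with \<open>X\<close>, \<open>Y\<close>, \<open>Z\<close> given by
  the exponents outside the slices \<open>p - 1\<close>, \<open>p\<close> and \<open>p + 1\<close> of \<open>U\<close>.
\<close>

theorem support_acyclic_delete_slice:
  assumes up: "up_closed U" "up_closed V"
    and low: "\<And>t. t < p \<Longrightarrow> slice i t V = slice i t U"
    and high: "\<And>t. p \<le> t \<Longrightarrow> slice i t V = slice i (Suc t) U"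
    and U: "support_acyclic TYPE('k::field) U j"
  shows "support_acyclic TYPE('k) V j"
  unfolding support_acyclic_def
proof
  fix a
  have acU: "acyclic_family TYPE('k) (koszul_support U b) j" for b
    using U by (simp add: support_acyclic_def)
  consider "a i < p" | "p < a i" | "a i = p" by linarith
  then show "acyclic_family TYPE('k) (koszul_support V a) j"
  proof cases
    case 1
    then have "koszul_support V a = koszul_support U (a(i := a i))"
      using low by (intro koszul_support_eq_slices) auto
    then show ?thesis using acU by simp
  next
    case 2
    then have "koszul_support V a = koszul_support U (a(i := Suc (a i)))"
      using high[of "a i"] high[of "a i - 1"] by (intro koszul_support_eq_slices) auto
    then show ?thesis using acU by simp
  next
    case 3
    define a' where "a' = a(i := Suc p)"
    have a'i: "a' i = Suc p" and rest': "rest i a' S = rest i a S" for S by (simp_all add: a'_def)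
    have nested: "slice i p U \<subseteq> slice i (Suc p) U"
    proof
      fix w assume "w \<in> slice i p U"
      moreover have "w(i := p) \<le> w(i := Suc p)" by (simp add: le_fun_def)
      ultimately show "w \<in> slice i (Suc p) U" using up(1) unfolding up_closed_def slice_def by blast
    qed
    note ks = koszul_support_slice[where i = i]
    show ?thesis
    proof (cases "p = 0")
      case False
      have le: "ind S \<le> a' \<longleftrightarrow> ind S \<le> a" for S
        using 3 False by (auto simp: ind_le_iff a'_def)
      have pred: "slice i (p - Suc 0) V = slice i (p - Suc 0) U" using low[of "p - 1"] False by simp
      have top: "slice i p V = slice i (Suc p) U" by (rule high) simp
      have nested': "slice i (p - Suc 0) U \<subseteq> slice i p U"
      proof
        fix w assume "w \<in> slice i (p - Suc 0) U"
        moreover have "w(i := p - Suc 0) \<le> w(i := p)" by (simp add: le_fun_def)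
        ultimately show "w \<in> slice i p U" using up(1) unfolding up_closed_def slice_def by blast
      qed
      show ?thesis
      proof (rule acyclic_splice[OF _ _ _ _ _ _ _ _ _ _ acU[of a] acU[of a'],
            where W = "{k. 1 \<le> a k}" and i = i])
        have a'k: "1 \<le> a' k \<longleftrightarrow> 1 \<le> a k" for k using 3 False by (simp add: a'_def)
        fix S k
        show "insert k S \<in> koszul_support U a'"
          if "S \<in> koszul_support U a'" "k \<in> {k. 1 \<le> a k}"
          using koszul_support_insert[OF up(1) that(1)] that(2) a'k by simp
        show "insert k S \<in> koszul_support V a"
          if "S \<in> koszul_support V a" "k \<in> {k. 1 \<le> a k}"
          using koszul_support_insert[OF up(2) that(1)] that(2) by simp
        show "k \<in> {k. 1 \<le> a k}" if "insert k S \<in> koszul_support U a"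
          using koszul_support_insertD[OF that] by simp
        show "k \<in> {k. 1 \<le> a k}" if "insert k S \<in> koszul_support U a'"
          using koszul_support_insertD[OF that] a'k by simp
        show "k \<in> {k. 1 \<le> a k}" if "insert k S \<in> koszul_support V a"
          using koszul_support_insertD[OF that] by simp
      next
        fix S
        assume S: "i \<notin> S"
        show "S \<in> koszul_support U a' \<longleftrightarrow> S \<in> koszul_support V a"
          using S 3 by (simp add: ks a'i rest' le top)
        show "S \<in> koszul_support U a" if "S \<in> koszul_support V a"
          using that S 3 nested by (auto simp: ks top)
        have "ind (insert i S) \<le> a \<longleftrightarrow> ind S \<le> a" using 3 False by (auto simp: ind_le_iff)
        then show "insert i S \<in> koszul_support U a'" if "S \<in> koszul_support U a"
          using that S 3 by (simp add: ks a'i rest' le)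
      next
        fix S
        assume S: "i \<in> S"
        show "S \<in> koszul_support U a \<longleftrightarrow> S \<in> koszul_support V a"
          using S 3 by (simp add: ks pred)
        show "S \<in> koszul_support V a" if "S \<in> koszul_support U a'"
          using that S 3 nested' by (auto simp: ks a'i rest' le pred)
      qed
    next
      case True
      have top: "slice i 0 V = slice i (Suc 0) U" using high[of 0] True by simp
      have a_i: "a i = 0" using 3 True by simp
      have a'k: "k \<noteq> i \<Longrightarrow> a' k = a k" for k by (simp add: a'_def)
      have le: "ind S \<le> a' \<longleftrightarrow> ind S \<le> a" "ind (insert i S) \<le> a' \<longleftrightarrow> ind S \<le> a"
        if "i \<notin> S" for S
        using that by (auto simp: ind_le_iff a'_def)
      have not_i: "S \<notin> koszul_support X a" if "i \<in> S" for S X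
        using that a_i by (auto simp: koszul_support_def ind_le_iff intro!: bexI[of _ i])
      show ?thesis
      proof (rule acyclic_splice_bottom[OF _ _ _ _ _ _ _ _ acU[of a] acU[of a'],
            where W = "{k. 1 \<le> a k}" and i = i])
        fix S k
        show "insert k S \<in> koszul_support V a"
          if "S \<in> koszul_support V a" "k \<in> {k. 1 \<le> a k}"
          using koszul_support_insert[OF up(2) that(1)] that(2) by simp
        show "k \<in> {k. 1 \<le> a k}" if "insert k S \<in> koszul_support U a"
          using koszul_support_insertD[OF that] by simp
        show "k \<in> {k. 1 \<le> a k}" if "insert k S \<in> koszul_support U a'" "k \<noteq> i"
          using koszul_support_insertD[OF that(1)] a'k[OF that(2)] by simp
      next
        fix S
        assume S: "i \<notin> S"
        show "S \<in> koszul_support U a' \<longleftrightarrow> S \<in> koszul_support V a"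
          using S a_i True by (simp add: ks a'i rest' le top)
        show "S \<in> koszul_support U a" if "S \<in> koszul_support V a"
          using that S a_i nested True by (auto simp: ks top)
        show "insert i S \<in> koszul_support U a' \<longleftrightarrow> S \<in> koszul_support U a"
          using S a_i True by (simp add: ks a'i rest' le)
      next
        fix S
        assume "i \<in> S"
        then show "S \<notin> koszul_support U a" "S \<notin> koszul_support V a" using not_i by auto
      qed
    qed
  qed
qed

section \<open>Depth of a cyclic module\<close>

lemma poly_ring_simps [simp]:
  "carrier poly_ring = UNIV" "mult poly_ring = (*)" "one poly_ring = 1"
  "zero poly_ring = 0" "add poly_ring = (+)"
  by (simp_all add: poly_ring_def)

lemma ideal_poly_ring_iff:
  fixes J :: "('n, 'k::field) mpoly set"
  shows "ideal J poly_ring \<longleftrightarrow> idl.subspace J"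
proof
  assume "ideal J poly_ring"
  then interpret J: ideal J "poly_ring :: ('n, 'k) mpoly ring" .
  show "idl.subspace J"
    using additive_subgroup.zero_closed[OF J.is_additive_subgroup]
      additive_subgroup.a_closed[OF J.is_additive_subgroup] J.I_l_closed
    by (intro idl.subspaceI) auto
next
  assume J: "idl.subspace J"
  interpret R: cring "poly_ring :: ('n, 'k) mpoly ring" by (rule poly_ring_cring)
  show "ideal J poly_ring"
  proof (rule idealI[OF R.ring_axioms])
    show "subgroup J (add_monoid poly_ring)"
    proof (rule R.add.subgroupI)
      fix a assume a: "a \<in> J"
      have "\<ominus>\<^bsub>poly_ring\<^esub> a = - a"
        using R.r_neg[of a] by (simp add: eq_neg_iff_add_eq_0 add.commute)
      then show "\<ominus>\<^bsub>poly_ring\<^esub> a \<in> J" using idl.subspace_neg[OF J a] by simp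
    qed (use J idl.subspace_0 idl.subspace_add in auto)
  qed (use idl.subspace_scale[OF J] in \<open>auto simp: mult.commute\<close>)
qed

lemma genideal_poly_ring:
  fixes S :: "('n, 'k::field) mpoly set"
  shows "Idl\<^bsub>poly_ring\<^esub> S = idl.span S"
  unfolding genideal_def ideal_poly_ring_iff idl.span_def hull_def by simp

lemma coset_eq:
  fixes J :: "('n, 'k::field) mpoly set"
  shows "J +>\<^bsub>poly_ring\<^esub> r = (\<lambda>h. h + r) ` J"
  by (auto simp: a_r_coset_def')

lemma coset_eq_iff:
  fixes J :: "('n, 'k::field) mpoly set"
  assumes J: "idl.subspace J"
  shows "J +>\<^bsub>poly_ring\<^esub> r = J +>\<^bsub>poly_ring\<^esub> s \<longleftrightarrow> r - s \<in> J"
proof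
  assume eq: "J +>\<^bsub>poly_ring\<^esub> r = J +>\<^bsub>poly_ring\<^esub> s"
  have "r \<in> J +>\<^bsub>poly_ring\<^esub> r" unfolding coset_eq using idl.subspace_0[OF J] by force
  then have "r \<in> J +>\<^bsub>poly_ring\<^esub> s" by (simp only: eq)
  then show "r - s \<in> J" unfolding coset_eq by auto
next
  assume rs: "r - s \<in> J"
  have "h + r \<in> (\<lambda>h. h + s) ` J" if "h \<in> J" for h
    using idl.subspace_add[OF J that rs] by (intro image_eqI[of _ _ "h + (r - s)"]) auto
  moreover have "h + s \<in> (\<lambda>h. h + r) ` J" if "h \<in> J" for h
    using idl.subspace_diff[OF J that rs] by (intro image_eqI[of _ _ "h - (r - s)"]) auto
  ultimately show "J +>\<^bsub>poly_ring\<^esub> r = J +>\<^bsub>poly_ring\<^esub> s" unfolding coset_eq by blast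
qed

lemma quotient_carrier:
  fixes J :: "('n, 'k::field) mpoly set"
  shows "carrier (quotient_module poly_ring J) = range (\<lambda>r. J +>\<^bsub>poly_ring\<^esub> r)"
  by (auto simp: quotient_module_simps FactRing_def A_RCOSETS_def')

lemma quotient_ops:
  fixes J :: "('n, 'k::field) mpoly set"
  assumes "idl.subspace J"
  shows "f \<odot>\<^bsub>quotient_module poly_ring J\<^esub> (J +>\<^bsub>poly_ring\<^esub> r) = J +>\<^bsub>poly_ring\<^esub> (f * r)"
    and "(J +>\<^bsub>poly_ring\<^esub> r) \<oplus>\<^bsub>quotient_module poly_ring J\<^esub> (J +>\<^bsub>poly_ring\<^esub> s) = J +>\<^bsub>poly_ring\<^esub> (r + s)"
    and "\<zero>\<^bsub>quotient_module poly_ring J\<^esub> = J +>\<^bsub>poly_ring\<^esub> 0"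
proof -
  interpret J: ideal J "poly_ring :: ('n, 'k) mpoly ring"
    using assms by (simp add: ideal_poly_ring_iff)
  have hom: "(+>\<^bsub>poly_ring\<^esub>) J \<in> ring_hom poly_ring (poly_ring Quot J)" by (rule J.rcos_ring_hom)
  show "f \<odot>\<^bsub>quotient_module poly_ring J\<^esub> (J +>\<^bsub>poly_ring\<^esub> r) = J +>\<^bsub>poly_ring\<^esub> (f * r)"
    using ring_hom_mult[OF hom, of f r] by (simp add: quotient_module_simps)
  show "(J +>\<^bsub>poly_ring\<^esub> r) \<oplus>\<^bsub>quotient_module poly_ring J\<^esub> (J +>\<^bsub>poly_ring\<^esub> s) = J +>\<^bsub>poly_ring\<^esub> (r + s)"
    using ring_hom_add[OF hom, of r s] by (simp add: quotient_module_simps)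
  show "\<zero>\<^bsub>quotient_module poly_ring J\<^esub> = J +>\<^bsub>poly_ring\<^esub> 0"
    by (simp add: quotient_module_simps FactRing_def coset_eq)
qed

lemma quotient_uminus:
  fixes J :: "('n, 'k::field) mpoly set"
  assumes J: "idl.subspace J"
  shows "\<ominus>\<^bsub>quotient_module poly_ring J\<^esub> (J +>\<^bsub>poly_ring\<^esub> r) = J +>\<^bsub>poly_ring\<^esub> (- r)"
proof -
  interpret M: Module.module "poly_ring :: ('n, 'k) mpoly ring" "quotient_module poly_ring J"
    using J by (intro quotient_module_module poly_ring_cring) (simp add: ideal_poly_ring_iff)
  show ?thesis
    by (rule M.minus_equality) (auto simp: quotient_ops[OF J] quotient_carrier)
qed

lemma submodule_quotient_iff:
  fixes J :: "('n, 'k::field) mpoly set"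
  assumes J: "idl.subspace J"
  shows "submodule N poly_ring (quotient_module poly_ring J) \<longleftrightarrow>
    (\<exists>K. idl.subspace K \<and> J \<subseteq> K \<and> N = (\<lambda>r. J +>\<^bsub>poly_ring\<^esub> r) ` K)"
proof
  let ?M = "quotient_module poly_ring J"
  assume N: "submodule N poly_ring ?M"
  interpret M: Module.module "poly_ring :: ('n, 'k) mpoly ring" ?M
    using J by (intro quotient_module_module poly_ring_cring) (simp add: ideal_poly_ring_iff)
  note N' = M.submoduleE[OF N]
  have zero: "\<zero>\<^bsub>?M\<^esub> \<in> N"
  proof -
    obtain n where n: "n \<in> N" using N'(2) by blast
    then obtain r where r: "n = J +>\<^bsub>poly_ring\<^esub> r" using N'(1) quotient_carrier by blast
    have "0 \<odot>\<^bsub>?M\<^esub> n \<in> N" using N'(4)[of 0 n] n by simp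
    then show ?thesis by (simp add: r quotient_ops[OF J])
  qed
  define K where "K = {r. J +>\<^bsub>poly_ring\<^esub> r \<in> N}"
  have "idl.subspace K"
  proof (rule idl.subspaceI)
    show "0 \<in> K" using zero by (simp add: K_def quotient_ops[OF J])
  next
    fix x y assume "x \<in> K" "y \<in> K"
    then show "x + y \<in> K" using N'(5) by (simp add: K_def flip: quotient_ops(2)[OF J])
  next
    fix c x assume "x \<in> K"
    then show "c * x \<in> K" using N'(4) by (simp add: K_def flip: quotient_ops(1)[OF J])
  qed
  moreover have "J \<subseteq> K"
  proof
    fix r assume "r \<in> J"
    then have "J +>\<^bsub>poly_ring\<^esub> r = J +>\<^bsub>poly_ring\<^esub> 0" by (simp add: coset_eq_iff[OF J])
    then show "r \<in> K" using zero by (simp add: K_def quotient_ops[OF J])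
  qed
  moreover have "N = (\<lambda>r. J +>\<^bsub>poly_ring\<^esub> r) ` K"
    using N'(1) quotient_carrier[of J] by (auto simp: K_def)
  ultimately show "\<exists>K. idl.subspace K \<and> J \<subseteq> K \<and> N = (\<lambda>r. J +>\<^bsub>poly_ring\<^esub> r) ` K" by blast
next
  let ?M = "quotient_module poly_ring J"
  interpret M: Module.module "poly_ring :: ('n, 'k) mpoly ring" ?M
    using J by (intro quotient_module_module poly_ring_cring) (simp add: ideal_poly_ring_iff)
  assume "\<exists>K. idl.subspace K \<and> J \<subseteq> K \<and> N = (\<lambda>r. J +>\<^bsub>poly_ring\<^esub> r) ` K"
  then obtain K where K: "idl.subspace K" "N = (\<lambda>r. J +>\<^bsub>poly_ring\<^esub> r) ` K" by blast
  show "submodule N poly_ring ?M"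
    unfolding K(2)
  proof (rule M.submoduleI)
    show "(\<lambda>r. J +>\<^bsub>poly_ring\<^esub> r) ` K \<subseteq> carrier ?M" by (auto simp: quotient_carrier)
    show "\<zero>\<^bsub>?M\<^esub> \<in> (\<lambda>r. J +>\<^bsub>poly_ring\<^esub> r) ` K"
      using idl.subspace_0[OF K(1)] by (simp add: quotient_ops[OF J])
  qed (use K(1) in \<open>auto simp: quotient_ops[OF J] quotient_uminus[OF J]
        intro!: imageI intro: idl.subspace_add idl.subspace_scale idl.subspace_neg\<close>)
qed

lemma ideal_times_quotient_module:
  fixes J :: "('n, 'k::field) mpoly set"
  assumes J: "idl.subspace J"
  shows "ideal_times_module poly_ring F (quotient_module poly_ring J) =
    (\<lambda>r. J +>\<^bsub>poly_ring\<^esub> r) ` idl.span (F \<union> J)"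
proof (rule equalityI)
  let ?M = "quotient_module poly_ring J" and ?c = "\<lambda>r. J +>\<^bsub>poly_ring\<^esub> r"
  have "submodule (?c ` idl.span (F \<union> J)) poly_ring ?M"
    unfolding submodule_quotient_iff[OF J]
    using idl.span_superset[of "F \<union> J"] by (intro exI[of _ "idl.span (F \<union> J)"]) auto
  moreover have "f \<odot>\<^bsub>?M\<^esub> x \<in> ?c ` idl.span (F \<union> J)" if fx: "f \<in> F" "x \<in> carrier ?M" for f x
  proof -
    obtain r where r: "x = ?c r" using fx(2) by (auto simp: quotient_carrier)
    have "r * f \<in> idl.span (F \<union> J)" using fx(1) by (intro idl.span_scale idl.span_base) simp
    then show ?thesis unfolding r quotient_ops[OF J] by (simp add: mult.commute)
  qed
  ultimately show "ideal_times_module poly_ring F ?M \<subseteq> ?c ` idl.span (F \<union> J)"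
    unfolding ideal_times_module_def by blast
  have "?c ` idl.span (F \<union> J) \<subseteq> N"
    if N: "submodule N poly_ring ?M" "\<forall>f\<in>F. \<forall>x\<in>carrier ?M. f \<odot>\<^bsub>?M\<^esub> x \<in> N" for N
  proof -
    obtain K where K: "idl.subspace K" "J \<subseteq> K" "N = ?c ` K"
      using N(1) unfolding submodule_quotient_iff[OF J] by blast
    have "f \<in> K" if "f \<in> F" for f
    proof -
      have "f \<odot>\<^bsub>?M\<^esub> (?c 1) \<in> N" using N(2) that by (simp add: quotient_carrier)
      then obtain k where "k \<in> K" "f - k \<in> J"
        by (auto simp: quotient_ops[OF J] K(3) coset_eq_iff[OF J])
      then show "f \<in> K" using K(1,2) idl.subspace_add[of K k "f - k"] by auto
    qed
    then have "idl.span (F \<union> J) \<subseteq> K" using K(1,2) by (intro idl.span_minimal) auto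
    then show ?thesis unfolding K(3) by blast
  qed
  then show "?c ` idl.span (F \<union> J) \<subseteq> ideal_times_module poly_ring F ?M"
    unfolding ideal_times_module_def by blast
qed

lemma coset_in_image_iff:
  fixes J :: "('n, 'k::field) mpoly set"
  assumes J: "idl.subspace J" and K: "idl.subspace K" "J \<subseteq> K"
  shows "J +>\<^bsub>poly_ring\<^esub> r \<in> (\<lambda>r. J +>\<^bsub>poly_ring\<^esub> r) ` K \<longleftrightarrow> r \<in> K"
proof
  assume "J +>\<^bsub>poly_ring\<^esub> r \<in> (\<lambda>r. J +>\<^bsub>poly_ring\<^esub> r) ` K"
  then obtain k where "k \<in> K" "r - k \<in> J" by (auto simp: coset_eq_iff[OF J])
  then show "r \<in> K" using K idl.subspace_add[of K k "r - k"] by auto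
qed simp

lemma regular_list_iff_nth:
  assumes "idl.subspace J"
  shows "regular_list J fs \<longleftrightarrow>
    (\<forall>k<length fs. regular_mod (idl.span (set (take k fs) \<union> J)) (fs ! k))"
  using assms
proof (induction fs arbitrary: J)
  case (Cons f fs)
  have span: "idl.span (A \<union> idl.span (insert f J)) = idl.span (insert f A \<union> J)" for A
  proof -
    have "idl.span (A \<union> idl.span (insert f J)) = idl.span (A \<union> insert f J)"
      unfolding idl.span_eq
      by (meson Un_least Un_upper1 Un_upper2 idl.span_mono idl.span_superset subset_trans)
    then show ?thesis by simp
  qed
  have J: "idl.span J = J" using Cons.prems by simp
  show ?case
    unfolding regular_list.simps Cons.IH[OF idl.subspace_span] span
    by (simp add: J All_less_Suc2)
qed simp

lemma regular_sequence_quotient_iff: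
  fixes J :: "('n, 'k::field) mpoly set"
  assumes J: "idl.subspace J"
  shows "regular_sequence poly_ring (quotient_module poly_ring J) fs \<longleftrightarrow>
    regular_list J fs \<and> idl.span (set fs \<union> J) \<noteq> UNIV"
proof -
  let ?c = "\<lambda>r. J +>\<^bsub>poly_ring\<^esub> r"
  have sup: "J \<subseteq> idl.span (F \<union> J)" for F using idl.span_superset[of "F \<union> J"] by auto
  have mem: "?c r \<in> ?c ` idl.span (F \<union> J) \<longleftrightarrow> r \<in> idl.span (F \<union> J)" for r F
    using coset_in_image_iff[OF J _ sup] by simp
  have "?c ` idl.span (set fs \<union> J) \<noteq> range ?c \<longleftrightarrow> idl.span (set fs \<union> J) \<noteq> UNIV"
  proof -
    have "?c ` K = range ?c \<longleftrightarrow> (\<forall>r. ?c r \<in> ?c ` K)" for K by auto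
    then show ?thesis by (simp only: mem) auto
  qed
  then show ?thesis
    unfolding regular_sequence_def ideal_times_quotient_module[OF J] quotient_carrier
      regular_list_iff_nth[OF J] regular_mod_def
    by (simp add: quotient_ops[OF J] mem)
qed

text \<open>
  Inside the ideal of the variables the requirement \<open>(fs) M \<noteq> M\<close> on a regular sequence holds
  automatically, so only regularity is left to express by Koszul homology.
\<close>

theorem depth_quotient_eq:
  fixes J :: "('n::finite, 'k::field) mpoly set"
  assumes J: "idl.subspace J" and max: "J \<subseteq> mono_ideal_gen (range var)"
    and proper: "1 \<notin> (mono_ideal_gen (range var) :: ('n, 'k) mpoly set)"
  shows "depth_quotient J = (SUP d \<in> {d. \<forall>j. j + d > card (UNIV :: 'n set) \<longrightarrow>
      koszul_exact (\<lambda>i. monom_of (var i)) J j}. enat d)"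
proof -
  let ?x = "\<lambda>i. monom_of (var i) :: ('n, 'k) mpoly"
  have \<mm>: "mono_ideal_gen (range var) = idl.span (range ?x)"
    by (simp add: mono_ideal_gen_def genideal_poly_ring image_image)
  have ne: "carrier (quotient_module poly_ring J) \<noteq> {\<zero>\<^bsub>quotient_module poly_ring J\<^esub>}"
  proof
    assume *: "carrier (quotient_module poly_ring J) = {\<zero>\<^bsub>quotient_module poly_ring J\<^esub>}"
    have "J +>\<^bsub>poly_ring\<^esub> 1 \<in> carrier (quotient_module poly_ring J)" by (simp add: quotient_carrier)
    then have "1 \<in> J" unfolding * by (simp add: quotient_ops[OF J] coset_eq_iff[OF J])
    then show False using max proper by blast
  qed
  have "regular_sequence poly_ring (quotient_module poly_ring J) fs \<longleftrightarrow> regular_list J fs"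
    if "set fs \<subseteq> idl.span (range ?x)" for fs
  proof -
    have "idl.span (set fs \<union> J) \<subseteq> idl.span (range ?x)"
      using that max unfolding \<mm> by (intro idl.span_minimal) auto
    then have "idl.span (set fs \<union> J) \<noteq> UNIV" using proper unfolding \<mm> by blast
    then show ?thesis by (simp add: regular_sequence_quotient_iff[OF J])
  qed
  then have "{fs. set fs \<subseteq> idl.span (range ?x) \<and>
        regular_sequence poly_ring (quotient_module poly_ring J) fs} =
      {fs. set fs \<subseteq> idl.span (range ?x) \<and> regular_list J fs}" by blast
  then have "depth_quotient J =
      (SUP d \<in> length ` {fs. set fs \<subseteq> idl.span (range ?x) \<and> regular_list J fs}. enat d)"
    using ne by (simp add: depth_quotient_def module_depth_def \<mm> image_image)
  also have "length ` {fs. set fs \<subseteq> idl.span (range ?x) \<and> regular_list J fs} =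
      {d. \<exists>fs. set fs \<subseteq> idl.span (range ?x) \<and> length fs = d \<and> regular_list J fs}" by auto
  also have "\<dots> = {d. \<forall>j. j + d > card (UNIV :: 'n set) \<longrightarrow> koszul_exact ?x J j}"
    using regular_list_iff_koszul_exact[OF regular_element_exists[OF hilbert_basis] J, of ?x] by blast
  finally show ?thesis .
qed

lemma depth_quotient_UNIV: "depth_quotient (UNIV :: ('n::finite, 'k::field) mpoly set) = \<infinity>"
proof -
  let ?J = "UNIV :: ('n, 'k) mpoly set"
  have "?J +>\<^bsub>poly_ring\<^esub> r = ?J +>\<^bsub>poly_ring\<^esub> 0" for r
    by (subst coset_eq_iff) simp_all
  then have "carrier (quotient_module poly_ring ?J) = {\<zero>\<^bsub>quotient_module poly_ring ?J\<^esub>}"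
    by (auto simp: quotient_carrier quotient_ops)
  then show ?thesis by (simp add: depth_quotient_def module_depth_def)
qed

section \<open>Depth of a monomial ideal\<close>

definition up_closure :: "('n \<Rightarrow>\<^sub>0 nat) set \<Rightarrow> ('n \<Rightarrow> nat) set" where
  "up_closure S = {u. \<exists>a\<in>S. Poly_Mapping.lookup a \<le> u}"

lemma up_closed_up_closure: "up_closed (up_closure S)"
  unfolding up_closed_def up_closure_def using order_trans by blast

lemma subspace_mono_set:
  fixes U :: "('n::finite \<Rightarrow> nat) set"
  assumes "up_closed U"
  shows "idl.subspace (mono_set U :: ('n, 'k::field) mpoly set)"
proof (rule idl.subspaceI)
  fix c f :: "('n, 'k) mpoly" assume f: "f \<in> mono_set U"
  show "c * f \<in> mono_set U"
    unfolding mono_set_def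
  proof (intro CollectI ballI)
    fix a assume "a \<in> Poly_Mapping.keys (c * f)"
    then obtain d b where "a = d + b" "b \<in> Poly_Mapping.keys f" using keys_mult[of c f] by blast
    then have "Poly_Mapping.lookup b \<in> U" "Poly_Mapping.lookup b \<le> Poly_Mapping.lookup a"
      using f by (auto simp: mono_set_def le_fun_def lookup_add)
    then show "Poly_Mapping.lookup a \<in> U" using assms by (auto simp: up_closed_def)
  qed
qed (auto simp: mono_set_iff lookup_add)

lemma mono_ideal_gen_eq_mono_set:
  "(mono_ideal_gen S :: ('n::finite, 'k::field) mpoly set) = mono_set (up_closure S)"
proof (rule equalityI)
  have "monom_of ` S \<subseteq> (mono_set (up_closure S) :: ('n, 'k) mpoly set)"
    by (auto simp: mono_set_def monom_of_def up_closure_def)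
  then show "mono_ideal_gen S \<subseteq> (mono_set (up_closure S) :: ('n, 'k) mpoly set)"
    unfolding mono_ideal_gen_def genideal_poly_ring
    by (rule idl.span_minimal) (rule subspace_mono_set[OF up_closed_up_closure])
  show "mono_set (up_closure S) \<subseteq> (mono_ideal_gen S :: ('n, 'k) mpoly set)"
  proof
    fix f :: "('n, 'k) mpoly" assume f: "f \<in> mono_set (up_closure S)"
    have expand: "f = (\<Sum>a\<in>Poly_Mapping.keys f. Poly_Mapping.single a (Poly_Mapping.lookup f a))"
      by (rule poly_mapping_eqI)
        (auto simp: lookup_sum lookup_single when_def in_keys_iff)
    have "Poly_Mapping.single a (Poly_Mapping.lookup f a) \<in> idl.span (monom_of ` S)"
      if "a \<in> Poly_Mapping.keys f" for a
    proof -
      have "Poly_Mapping.lookup a \<in> up_closure S" using f that by (simp add: mono_set_def)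
      then obtain s where s: "s \<in> S" "Poly_Mapping.lookup s \<le> Poly_Mapping.lookup a"
        unfolding up_closure_def by blast
      have "a = (a - s) + s"
        using s(2) by (intro poly_mapping_eqI) (simp add: lookup_add lookup_minus le_fun_def)
      then have "Poly_Mapping.single a (Poly_Mapping.lookup f a) =
          Poly_Mapping.single (a - s) (Poly_Mapping.lookup f a) * monom_of s"
        by (simp add: monom_of_def mult_single)
      then show ?thesis using s(1) by (metis idl.span_base idl.span_scale imageI)
    qed
    then have "(\<Sum>a\<in>Poly_Mapping.keys f. Poly_Mapping.single a (Poly_Mapping.lookup f a))
        \<in> idl.span (monom_of ` S)" by (rule idl.span_sum)
    then show "f \<in> mono_ideal_gen S"
      unfolding mono_ideal_gen_def genideal_poly_ring expand[symmetric] .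
  qed
qed

lemma mono_ideal_gen_eq_iff:
  "(mono_ideal_gen S :: ('n::finite, 'k::field) mpoly set) = mono_ideal_gen T \<longleftrightarrow>
    up_closure S = up_closure T"
proof
  assume eq: "(mono_ideal_gen S :: ('n, 'k) mpoly set) = mono_ideal_gen T"
  have "u \<in> up_closure X \<longleftrightarrow>
      Poly_Mapping.single (Abs_poly_mapping u) 1 \<in> (mono_ideal_gen X :: ('n, 'k) mpoly set)" for u X
    unfolding mono_ideal_gen_eq_mono_set by (simp add: mono_set_def)
  then show "up_closure S = up_closure T" using eq by blast
qed (simp add: mono_ideal_gen_eq_mono_set)

theorem depth_quotient_mono_ideal:
  fixes S :: "('n::finite \<Rightarrow>\<^sub>0 nat) set"
  shows "depth_quotient (mono_ideal_gen S :: ('n, 'k::field) mpoly set) =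
    (if (\<lambda>_. 0) \<in> up_closure S then \<infinity>
     else SUP d \<in> {d. \<forall>j. j + d > card (UNIV :: 'n set) \<longrightarrow>
       support_acyclic TYPE('k) (up_closure S) j}. enat d)"
proof (cases "(\<lambda>_. 0) \<in> up_closure S")
  case True
  then have "up_closure S = UNIV"
    using up_closed_up_closure[of S] unfolding up_closed_def by (auto simp: le_fun_def)
  then have "(mono_ideal_gen S :: ('n, 'k) mpoly set) = UNIV"
    by (simp add: mono_ideal_gen_eq_mono_set mono_set_def)
  then show ?thesis using True by (simp add: depth_quotient_UNIV)
next
  case False
  let ?J = "mono_ideal_gen S :: ('n, 'k) mpoly set"
  let ?m = "mono_ideal_gen (range var) :: ('n, 'k) mpoly set"
  have var_iff: "u \<in> up_closure (range (var :: 'n \<Rightarrow> _)) \<longleftrightarrow> u \<noteq> (\<lambda>_. 0)" for u :: "'n \<Rightarrow> nat"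
  proof -
    have "Poly_Mapping.lookup (var i) \<le> u \<longleftrightarrow> u i \<noteq> 0" for i
      by (auto simp: var_def le_fun_def lookup_single when_def)
    then show ?thesis by (auto simp: up_closure_def)
  qed
  have J: "idl.subspace ?J"
    unfolding mono_ideal_gen_eq_mono_set by (rule subspace_mono_set[OF up_closed_up_closure])
  have "?J \<subseteq> ?m"
    unfolding mono_ideal_gen_eq_mono_set mono_set_def var_iff using False by auto
  moreover have "1 \<notin> ?m"
    unfolding mono_ideal_gen_eq_mono_set mono_set_def var_iff by (simp add: zero_poly_mapping.rep_eq)
  ultimately have "depth_quotient ?J = (SUP d \<in> {d. \<forall>j. j + d > card (UNIV :: 'n set) \<longrightarrow>
      koszul_exact (\<lambda>i. monom_of (var i)) ?J j}. enat d)"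
    by (rule depth_quotient_eq[OF J])
  moreover have "koszul_exact (\<lambda>i. monom_of (var i)) ?J j \<longleftrightarrow>
      support_acyclic TYPE('k) (up_closure S) j" for j
  proof -
    have all_lookup: "(\<forall>a :: 'n \<Rightarrow>\<^sub>0 nat. P (Poly_Mapping.lookup a)) \<longleftrightarrow> (\<forall>a. P a)" for P
      by (metis (mono_tags) finite lookup_Abs_poly_mapping)
    show ?thesis
      unfolding mono_ideal_gen_eq_mono_set koszul_exact_mono_set_iff[OF up_closed_up_closure]
        support_acyclic_def by (rule all_lookup)
  qed
  ultimately show ?thesis using False by simp
qed

lemma minimal_generators_antichain:
  fixes G :: "('n::finite \<Rightarrow>\<^sub>0 nat) set"
  assumes "minimal_monomial_generators (I :: ('n, 'k::field) mpoly set) G"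
    and ab: "a \<in> G" "b \<in> G" "Poly_Mapping.lookup a \<le> Poly_Mapping.lookup b"
  shows "a = b"
proof (rule ccontr)
  assume "a \<noteq> b"
  have "up_closure (G - {b}) = up_closure G"
    using ab \<open>a \<noteq> b\<close> order_trans[OF ab(3)] unfolding up_closure_def by blast
  then have "mono_ideal_gen (G - {b}) = I"
    using assms(1) by (metis minimal_monomial_generators_def mono_ideal_gen_eq_iff)
  moreover have "G - {b} \<subset> G" using ab(2) by blast
  ultimately show False using assms(1) by (auto simp: minimal_monomial_generators_def)
qed

lemma minimal_generators_finite:
  fixes G :: "('n::finite \<Rightarrow>\<^sub>0 nat) set"
  assumes "minimal_monomial_generators (I :: ('n, 'k::field) mpoly set) G"
  shows "finite G"
proof -
  have "finite (Poly_Mapping.lookup ` G)"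
    by (rule antichain_finite) (use minimal_generators_antichain[OF assms] in auto)
  moreover have "inj_on Poly_Mapping.lookup G" by (auto intro: inj_onI poly_mapping_eqI)
  ultimately show ?thesis by (rule finite_imageD)
qed

section \<open>Lowering the generators of top degree\<close>

lemma slice_up_closure:
  "w \<in> slice i t (up_closure S) \<longleftrightarrow>
    (\<exists>g\<in>S. deg_in i g \<le> t \<and> (\<forall>k. k \<noteq> i \<longrightarrow> deg_in k g \<le> w k))"
proof -
  have "Poly_Mapping.lookup g \<le> w(i := t) \<longleftrightarrow>
      deg_in i g \<le> t \<and> (\<forall>k. k \<noteq> i \<longrightarrow> deg_in k g \<le> w k)" for g
    by (auto simp: le_fun_def deg_in_def)
  then show ?thesis by (simp add: slice_def up_closure_def)
qed

lemma slice_lowered: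
  assumes B: "\<And>g. g \<in> B \<Longrightarrow> deg_in i g = q"
  shows "w \<in> slice i t (up_closure ((\<lambda>a. a - Poly_Mapping.single i m) ` B \<union> A)) \<longleftrightarrow>
    w \<in> slice i t (up_closure A) \<or> q - m \<le> t \<and> (\<exists>g\<in>B. \<forall>k. k \<noteq> i \<longrightarrow> deg_in k g \<le> w k)"
proof -
  have 1: "deg_in i (g - Poly_Mapping.single i m) = q - m" if "g \<in> B" for g
    using B[OF that] by (simp add: deg_in_def lookup_minus)
  have 2: "deg_in k (g - Poly_Mapping.single i m) = deg_in k g" if "k \<noteq> i" for g k
    using that by (simp add: deg_in_def lookup_minus lookup_single when_def)
  show ?thesis
    unfolding slice_up_closure bex_Un bex_simps(7) by (auto simp: 1 2 cong: bex_cong)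
qed

text \<open>
  Generators in \<open>A\<close> have degree at most \<open>p\<close> in \<open>x\<^sub>i\<close>, so from \<open>p\<close> on they contribute the same
  monomials to every slice; those in \<open>B\<close> enter at \<open>q\<close>, and at \<open>q - m\<close> after the division.
\<close>

lemma slices_of_lowered_top:
  fixes A B :: "('n::finite \<Rightarrow>\<^sub>0 nat) set"
  assumes B: "\<And>g. g \<in> B \<Longrightarrow> deg_in i g = q" and A: "\<And>g. g \<in> A \<Longrightarrow> deg_in i g \<le> p"
    and p: "p \<le> q - m"
  defines "U \<equiv> up_closure (A \<union> B)"
    and "V \<equiv> up_closure ((\<lambda>a. a - Poly_Mapping.single i m) ` B \<union> A)"
  shows "t < q - m \<Longrightarrow> slice i t V = slice i t U"
    and "q - m \<le> t \<Longrightarrow> slice i t V = slice i (t + m) U"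
    and "p \<le> t \<Longrightarrow> t < q \<Longrightarrow> slice i t U = slice i p U"
proof -
  have V: "w \<in> slice i t V \<longleftrightarrow>
      w \<in> slice i t (up_closure A) \<or> q - m \<le> t \<and> (\<exists>g\<in>B. \<forall>k. k \<noteq> i \<longrightarrow> deg_in k g \<le> w k)" for w t
    unfolding V_def by (rule slice_lowered[OF B])
  have U: "w \<in> slice i t U \<longleftrightarrow>
      w \<in> slice i t (up_closure A) \<or> q \<le> t \<and> (\<exists>g\<in>B. \<forall>k. k \<noteq> i \<longrightarrow> deg_in k g \<le> w k)" for w t
    unfolding U_def slice_up_closure using B by auto
  have stable: "slice i t (up_closure A) = slice i p (up_closure A)" if "p \<le> t" for t
  proof -
    have "deg_in i g \<le> t" if "g \<in> A" for g using A[OF that] \<open>p \<le> t\<close> by simp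
    then show ?thesis using A unfolding set_eq_iff slice_up_closure by (simp cong: bex_cong)
  qed
  show "slice i t V = slice i t U" if "t < q - m"
    using that by (auto simp: set_eq_iff U V)
  show "slice i t V = slice i (t + m) U" if t: "q - m \<le> t"
  proof -
    have "slice i t (up_closure A) = slice i (t + m) (up_closure A)"
      using stable[of t] stable[of "t + m"] t p by simp
    moreover have "q \<le> t + m" using t by simp
    ultimately show ?thesis using t by (auto simp: set_eq_iff U V)
  qed
  show "slice i t U = slice i p U" if "p \<le> t" "t < q"
    using stable[of t] that by (auto simp: set_eq_iff U)
qed

lemma zero_in_iff_slice: "(\<lambda>_. 0) \<in> U \<longleftrightarrow> (\<lambda>_. 0) \<in> slice i 0 U"
  by (simp add: slice_def fun_upd_def)

theorem theorem3p1:
  fixes I L :: "('n::finite, 'k::field) mpoly set"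
    and G A B :: "('n \<Rightarrow>\<^sub>0 nat) set"
    and i :: 'n
    and p q :: nat
  assumes "monomial_ideal I"
    and "minimal_monomial_generators I G"
    and "\<exists>a\<in>G. deg_in i a \<ge> 1"
    and "q = Max (deg_in i ` G)"
    and "B = {a \<in> G. deg_in i a = q}"
    and "A = G - B"
    and "p = (if A = {} then 0 else Max (deg_in i ` A))"
    and "L = mono_ideal_gen ((\<lambda>a. a - var i) ` B \<union> A)"
  shows "(p \<ge> 1 \<and> q - p \<ge> 2 \<longrightarrow> depth_quotient I = depth_quotient L) \<and>
    (p \<ge> 0 \<and> q - p = 1 \<longrightarrow> depth_quotient L \<ge> depth_quotient I) \<and>
    (p = 0 \<and> q \<ge> 2 \<longrightarrow>
       depth_quotient I =
       depth_quotient
         (mono_ideal_gen ((\<lambda>a. a - Poly_Mapping.single i (q - 1)) ` B \<union> A) :: ('n, 'k) mpoly set))"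
proof -
  define lowered where "lowered m = (\<lambda>a. a - Poly_Mapping.single i m) ` B \<union> A" for m
  let ?depth = "\<lambda>S. depth_quotient (mono_ideal_gen S :: ('n, 'k) mpoly set)"
  have I: "I = mono_ideal_gen G" using assms(2) by (simp add: minimal_monomial_generators_def)
  have L: "L = mono_ideal_gen (lowered 1)" by (simp add: assms(8) lowered_def var_def)
  have G: "G = A \<union> B" using assms(5,6) by auto
  have "finite G" by (rule minimal_generators_finite[OF assms(2)])
  have degB: "deg_in i g = q" if "g \<in> B" for g using that assms(5) by simp
  have degA: "deg_in i g \<le> p" if "g \<in> A" for g
  proof -
    have "deg_in i g \<le> Max (deg_in i ` A)"
      using that \<open>finite G\<close> G by (intro Max_ge) auto
    then show ?thesis using that assms(7) by auto
  qed
  have not_zero: "(\<lambda>_. 0) \<notin> up_closure G"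
  proof
    assume "(\<lambda>_. 0) \<in> up_closure G"
    then obtain g where g: "g \<in> G" "Poly_Mapping.lookup g \<le> (\<lambda>_. 0)" by (auto simp: up_closure_def)
    obtain a where a: "a \<in> G" "deg_in i a \<ge> 1" using assms(3) by blast
    have g0: "Poly_Mapping.lookup g k = 0" for k using g(2) by (simp add: le_fun_def)
    then have "g = a"
      using g(1) a(1) by (intro minimal_generators_antichain[OF assms(2)]) (simp_all add: le_fun_def)
    then show False using a(2) g0 by (simp add: deg_in_def)
  qed
  \<comment> \<open>If \<open>q - m\<close> still exceeds \<open>p\<close>, all deleted slices repeat slice \<open>q - m - 1\<close>.\<close>
  have same: "?depth G = ?depth (lowered m)" if m: "p < q - m" for m
  proof -
    have p: "p \<le> q - m" using m by simp
    note slices = slices_of_lowered_top[where A = A and B = B, OF degB degA p, folded G lowered_def]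
    have "support_acyclic TYPE('k) (up_closure (lowered m)) j \<longleftrightarrow>
        support_acyclic TYPE('k) (up_closure G) j" for j
    proof (rule support_acyclic_remove_repeated_slices[where i = i and r = "q - m" and m = m])
      show "slice i t (up_closure G) = slice i (q - m - 1) (up_closure G)"
        if "q - m - 1 \<le> t" "t \<le> q - m - 1 + m" for t
        using slices(3)[where t = t] slices(3)[where t = "q - m - 1"] that m by simp
    qed (use m slices(1,2) in auto)
    moreover have "(\<lambda>_. 0) \<notin> up_closure (lowered m)"
      using not_zero slices(1)[where t = 0] m
      unfolding zero_in_iff_slice[of "up_closure G" i]
        zero_in_iff_slice[of "up_closure (lowered m)" i] by simp
    ultimately show ?thesis using not_zero by (simp add: depth_quotient_mono_ideal)
  qed
  \<comment> \<open>If \<open>q = p + 1\<close>, slice \<open>p\<close> is deleted; the result is the unit ideal when \<open>x\<^sub>i\<close> itself is a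
    generator, and its quotient then has infinite depth.\<close>
  have "?depth G \<le> ?depth (lowered 1)" if q: "q = p + 1"
  proof (cases "(\<lambda>_. 0) \<in> up_closure (lowered 1)")
    case True
    then show ?thesis by (simp add: depth_quotient_mono_ideal)
  next
    case False
    have "p \<le> q - 1" using q by simp
    note slices = slices_of_lowered_top[where A = A and B = B, OF degB degA this, folded G lowered_def]
    have "support_acyclic TYPE('k) (up_closure (lowered 1)) j"
      if "support_acyclic TYPE('k) (up_closure G) j" for j
      by (rule support_acyclic_delete_slice[OF up_closed_up_closure up_closed_up_closure _ _ that,
            where i = i and p = p]) (use slices(1,2) q in auto)
    then show ?thesis
      using not_zero False by (auto simp: depth_quotient_mono_ideal intro!: SUP_subset_mono)
  qed
  moreover have "?depth G = ?depth (lowered 1)" if "q - p \<ge> 2"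
    using that by (intro same) auto
  moreover have "?depth G = ?depth (lowered (q - 1))" if "p = 0" "q \<ge> 2"
    using that by (intro same) auto
  ultimately show ?thesis
    unfolding I L by (auto simp: lowered_def)
qed

end
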